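(* Let $n\ge4$ and $1\le k\le\ell\le n-2$. Then: (1) $\sigma_n(k,k)=\binom{n-1}{k}-1$; (2) $\sigma_n(k,\ell-1)+\sigma_n(k,\ell)+\left(\binom{n-1}{k-1}+\ell-k\right)=\sigma_{n+1}(k,\ell)$; (3) for fixed $k$ and $\ell$, $\sigma_n(k,\ell)$ is a polynomial in $n$ of degree $\ell$.
   Context: To a $2$-subset $B\subseteq[n]$ associate the monotone lattice path from $(0,0)$ to $(n-2,2)$ whose $i$-th step is north iff $i\in B$. For such paths $U$ weakly above $L$, $M[U,L]$ is the rank-$2$ matroid on $[n]$ whose bases are the $2$-subsets whose paths lie between $U$ and $L$. For $n\ge4$ and $1\le k\le\ell\le n-2$, $M_n[k,\ell]$ denotes $M[U,L]$ with $U=\{1,n-\ell\}$ and $L=\{n-k+1,n\}$. $\sigma_n(k,\ell)$ denotes the normalized volume (volume normalized so that a unimodular simplex in the affine lattice of its affine hull has volume $1$) of the matroid polytope $P_{M_n[k,\ell]}=\mathrm{conv}\{e_B:B\text{ a basis}\}$, for $n\ge4$ and $1\le k\le\ell\le n-2$; set $\sigma_n(k,\ell)=0$ for all other values of $n,k,\ell$.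
   Formalization: The lower path is taken as L={n-k,n} instead of {n-k+1,n}: the latter is not a 2-subset for k=1, and for n=4, k=ℓ=2 it gives U_{2,4} of normalized volume 4, contradicting (1), which gives 2. *)

theory Defs
  imports
    "HOL-Analysis.Analysis"
    "HOL-Analysis.Finite_Function_Topology"
    "HOL-Computational_Algebra.Polynomial"
begin

text \<open>
  Since \<open>n\<close> varies inside the statement, \<open>\<real>\<^sup>n\<close> is realised as the coordinate subspace of
  \<^typ>\<open>nat \<Rightarrow>\<^sub>0 real\<close> with coordinates \<open>1,\<dots>,n\<close>, and \<open>\<int>\<^sup>n\<close> as the integer points in it. Convex hulls,
  affine hulls and the integer points of an affine hull do not depend on the ambient \<open>n\<close>.
\<close>

definition lattice_points :: "(nat \<Rightarrow>\<^sub>0 real) set" where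
  "lattice_points = {x. \<forall>i. Poly_Mapping.lookup x i \<in> \<int>}"

text \<open>
  \<open>p, v\<^sub>0, \<dots>, v\<^bsub>d-1\<^esub>\<close> is an affine frame of \<open>A\<close> which is also an affine \<open>\<int>\<close>-basis of the lattice
  points of \<open>A\<close>; equivalently, \<open>p, p + v\<^sub>0, \<dots>, p + v\<^bsub>d-1\<^esub>\<close> are the vertices of a full-dimensional
  unimodular simplex of \<open>A\<close>.
\<close>

definition affine_lattice_basis ::
    "(nat \<Rightarrow>\<^sub>0 real) set \<Rightarrow> (nat \<Rightarrow>\<^sub>0 real) \<Rightarrow> nat \<Rightarrow> (nat \<Rightarrow> (nat \<Rightarrow>\<^sub>0 real)) \<Rightarrow> bool" where
  "affine_lattice_basis A p d v \<longleftrightarrow>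
     inj_on v {..<d} \<and> independent (v ` {..<d}) \<and>
     A = range (\<lambda>t. p + (\<Sum>i<d. t i *\<^sub>R v i)) \<and>
     A \<inter> lattice_points = range (\<lambda>z. p + (\<Sum>i<d. real_of_int (z i) *\<^sub>R v i))"

text \<open>
  In the coordinates given by a lattice basis a unimodular simplex is the standard simplex, of
  Lebesgue measure \<open>1 / d!\<close>; hence the factor \<open>d!\<close>. Two lattice bases of the same affine hull differ
  by an affine unimodular map, so the value does not depend on the choice.
\<close>

definition normalized_volume :: "(nat \<Rightarrow>\<^sub>0 real) set \<Rightarrow> real" where
  "normalized_volume P = (THE x. \<exists>p d v. affine_lattice_basis (affine hull P) p d v \<and>
     x = fact d * measure (Pi\<^sub>M {..<d} (\<lambda>_. lborel))
           {t \<in> {..<d} \<rightarrow>\<^sub>E UNIV. p + (\<Sum>i<d. t i *\<^sub>R v i) \<in> P})"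

text \<open>A matroid is given by its ground set and its set of bases.\<close>

type_synonym matroid = "nat set \<times> nat set set"

definition indicator_vector :: "nat set \<Rightarrow> (nat \<Rightarrow>\<^sub>0 real)" where
  "indicator_vector B = (\<Sum>i\<in>B. Poly_Mapping.single i 1)"

definition matroid_polytope :: "matroid \<Rightarrow> (nat \<Rightarrow>\<^sub>0 real) set" where
  "matroid_polytope M = convex hull (indicator_vector ` snd M)"

text \<open>The point reached after \<open>i\<close> steps, the \<open>j\<close>-th step being north if \<open>j \<in> B\<close> and east otherwise.\<close>

definition lattice_path :: "nat set \<Rightarrow> nat \<Rightarrow> nat \<times> nat" where
  "lattice_path B i = (card ({1..i} - B), card ({1..i} \<inter> B))"

text \<open>After \<open>i\<close> steps all paths are on the antidiagonal \<open>x + y = i\<close>, so heights can be compared there.\<close>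

definition weakly_above :: "nat \<Rightarrow> nat set \<Rightarrow> nat set \<Rightarrow> bool" where
  "weakly_above n U L \<longleftrightarrow> (\<forall>i\<le>n. snd (lattice_path L i) \<le> snd (lattice_path U i))"

definition lattice_path_matroid :: "nat \<Rightarrow> nat set \<Rightarrow> nat set \<Rightarrow> matroid" where
  "lattice_path_matroid n U L =
     ({1..n}, {B. B \<subseteq> {1..n} \<and> card B = 2 \<and> weakly_above n U B \<and> weakly_above n B L})"

text \<open>
  The lower path is \<open>{n - k, n}\<close>. The definition with \<open>{n - k + 1, n}\<close> is an off-by-one slip:
  for \<open>k = 1\<close> it is not a 2-subset, and for \<open>n = 4\<close>, \<open>k = \<ell> = 2\<close> it gives the uniform matroid
  \<open>U\<^bsub>2,4\<^esub>\<close>, whose polytope (the octahedron) has normalized volume 4 instead of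
  \<open>(3 choose 2) - 1 = 2\<close>. With \<open>{n - k, n}\<close> the whole range \<open>1 \<le> k \<le> \<ell> \<le> n - 2\<close> makes sense.
\<close>

definition M_lpm :: "nat \<Rightarrow> nat \<Rightarrow> nat \<Rightarrow> matroid" where
  "M_lpm n k l = lattice_path_matroid n {1, n - l} {n - k, n}"

definition \<sigma> :: "nat \<Rightarrow> nat \<Rightarrow> nat \<Rightarrow> real" where
  "\<sigma> n k l = (if 4 \<le> n \<and> 1 \<le> k \<and> k \<le> l \<and> l \<le> n - 2
               then normalized_volume (matroid_polytope (M_lpm n k l)) else 0)"

end

theory Submission
  imports Defs
begin

text \<open>
  \<open>M\<^sub>n[k,\<ell>]\<close> is the rank-two matroid on \<open>[n]\<close> whose parallel classes are \<open>{1,\<dots>,n-\<ell>-1}\<close>,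
  \<open>{n-k+1,\<dots>,n}\<close> and \<open>\<ell>-k+1\<close> singletons. The polytope of a rank-two matroid with parallel classes \<open>\<C>\<close>
  is obtained from the dilated simplex \<open>2\<Delta>\<close>, of normalized volume \<open>2\<^sup>n\<^sup>-\<^sup>1\<close>, by cutting off the
  disjoint pieces \<open>{x. \<Sum>\<^bsub>i\<in>C\<^esub> x\<^sub>i > 1}\<close> for \<open>C \<in> \<C>\<close>, and such a piece has normalized volume
  \<open>\<Sum>\<^bsub>i<|C|\<^esub> (n-1 choose i)\<close>. Hence \<open>\<sigma>\<^sub>n(k,\<ell>) = \<Sum>\<^bsub>k\<le>i\<le>\<ell>\<^esub> ((n-1 choose i) - 1)\<close>, from which all
  three claims follow by Pascal's rule.
\<close>

section \<open>Translation-invariant measures on finite products of the real line\<close>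

text \<open>\<open>normalized_volume\<close> is a definite description over all lattice bases of the
  affine hull, so no volume can be computed before independence of the basis is known. Two lattice
  bases differ by an affine automorphism of the integer lattice. That such a map preserves Lebesgue
  measure is shown without determinants: the image measure is again translation invariant, hence a
  multiple of Lebesgue measure, and the factor is 1 because the preimage of the unit cube is a
  fundamental domain of the lattice. The cut-off pieces are disjoint because the coordinates are
  nonnegative with sum 2, so two classes cannot both weigh more than 1. Their binomial volumes are
  those of order statistics: a simplex consists of the gaps between sorted points, and bounding the
  sum of c gaps asks for at least c points in an interval. In the final formula the last class
  removes the k lowest entries of the binomial row with sum 2^(n-1), the first class by symmetry the
  entries above position l, and each singleton removes 1; the entries from k to l survive.\<close>

abbreviation lborel_on :: "'a set \<Rightarrow> ('a \<Rightarrow> real) measure" where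
  "lborel_on I \<equiv> Pi\<^sub>M I (\<lambda>_. lborel)"

text \<open>Restricted to \<open>I\<close> because the points of the product space are extensional
  functions.\<close>

definition translate_on :: "'a set \<Rightarrow> ('a \<Rightarrow> real) \<Rightarrow> ('a \<Rightarrow> real) \<Rightarrow> 'a \<Rightarrow> real" where
  "translate_on I a x = (\<lambda>i\<in>I. a i + x i)"

lemma translate_on_apply [simp]: "i \<in> I \<Longrightarrow> translate_on I a x i = a i + x i"
  by (simp add: translate_on_def)

lemma translate_on_in [simp]: "translate_on I a x \<in> I \<rightarrow>\<^sub>E UNIV"
  by (simp add: translate_on_def)

lemma translate_on_in_space [simp]: "translate_on I a x \<in> space (lborel_on I)"
  by (simp add: space_PiM)

text \<open>Joint measurability in the shift and the point is what the exchange of integrals in the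
  uniqueness argument requires.\<close>

lemma measurable_translate_on [measurable]:
  assumes "f \<in> M \<rightarrow>\<^sub>M lborel_on I" "g \<in> M \<rightarrow>\<^sub>M lborel_on I"
  shows "(\<lambda>x. translate_on I (f x) (g x)) \<in> M \<rightarrow>\<^sub>M lborel_on I"
  unfolding translate_on_def
proof (rule measurable_restrict)
  fix i assume "i \<in> I"
  note i = measurable_component_singleton[OF this, of "\<lambda>_. lborel :: real measure"]
  have "(\<lambda>x. f x i) \<in> borel_measurable M" "(\<lambda>x. g x i) \<in> borel_measurable M"
    using measurable_compose[OF assms(1) i] measurable_compose[OF assms(2) i] by simp_all
  then show "(\<lambda>x. f x i + g x i) \<in> M \<rightarrow>\<^sub>M lborel"
    by simp
qed

lemma measurable_translate_on_const [measurable]: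
  "translate_on I a \<in> lborel_on I \<rightarrow>\<^sub>M lborel_on I"
  unfolding translate_on_def[abs_def] by measurable

lemma PiE_UNIV_eqI:
  assumes "x \<in> I \<rightarrow>\<^sub>E UNIV" "y \<in> I \<rightarrow>\<^sub>E UNIV" "\<And>i. i \<in> I \<Longrightarrow> x i = y i"
  shows "x = y"
  using assms by (auto simp: PiE_def intro: extensionalityI)

lemma distr_lborel_on_translate:
  assumes I: "finite I"
  shows "distr (lborel_on I) (lborel_on I) (translate_on I a) = lborel_on I"
proof -
  interpret product_sigma_finite "\<lambda>_::'a. lborel :: real measure"
    by standard
  show ?thesis
  proof (rule PiM_eqI[OF I])
    fix A :: "'a \<Rightarrow> real set" assume A: "\<And>i. i \<in> I \<Longrightarrow> A i \<in> sets lborel"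
    have eq: "translate_on I a -` Pi\<^sub>E I A \<inter> space (lborel_on I) = Pi\<^sub>E I (\<lambda>i. (+) (a i) -` A i)"
      by (auto simp: space_PiM translate_on_def PiE_iff)
    have m: "(+) (a i) -` A i \<in> sets lborel" if "i \<in> I" for i
      using measurable_sets[of "(+) (a i)" borel borel "A i"] A[OF that] by simp
    have "emeasure (distr (lborel_on I) (lborel_on I) (translate_on I a)) (Pi\<^sub>E I A)
        = emeasure (lborel_on I) (Pi\<^sub>E I (\<lambda>i. (+) (a i) -` A i))"
      using A I by (subst emeasure_distr) (auto simp: eq intro!: sets_PiM_I_finite)
    also have "\<dots> = (\<Prod>i\<in>I. emeasure lborel ((+) (a i) -` A i))"
      using m by (intro emeasure_PiM I)
    also have "\<dots> = (\<Prod>i\<in>I. emeasure lborel (A i))"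
    proof (rule prod.cong[OF refl])
      fix i assume i: "i \<in> I"
      have "emeasure lborel (A i) = emeasure (distr lborel borel ((+) (a i))) (A i)"
        by (simp add: lborel_distr_plus)
      also have "\<dots> = emeasure lborel ((+) (a i) -` A i)"
        using A[OF i] by (subst emeasure_distr) auto
      finally show "emeasure lborel ((+) (a i) -` A i) = emeasure lborel (A i)" ..
    qed
    finally show "emeasure (distr (lborel_on I) (lborel_on I) (translate_on I a)) (Pi\<^sub>E I A)
        = (\<Prod>i\<in>I. emeasure lborel (A i))" .
  qed simp
qed

lemma sigma_finite_lborel_on:
  "finite I \<Longrightarrow> sigma_finite_measure (lborel_on I)"
proof -
  interpret product_sigma_finite "\<lambda>_::'a. lborel :: real measure" by standard
  show "finite I \<Longrightarrow> ?thesis" by (rule sigma_finite)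
qed

lemma emeasure_lborel_on_box:
  assumes "finite I" "\<And>i. i \<in> I \<Longrightarrow> A i \<in> sets lborel"
  shows "emeasure (lborel_on I) (Pi\<^sub>E I A) = (\<Prod>i\<in>I. emeasure lborel (A i))"
proof -
  interpret product_sigma_finite "\<lambda>_::'a. lborel :: real measure" by standard
  show ?thesis using assms by (rule emeasure_PiM)
qed

text \<open>Uniqueness of Haar measure: integrate \<open>1\<^sub>F(x) 1\<^sub>S(x + y)\<close> with \<open>F = (-1, 0]\<^sup>I\<close> in both orders.\<close>

lemma translation_invariant_eq_lborel_on:
  assumes I: "finite I"
    and sets_N [measurable_cong]: "sets N = sets (lborel_on I)"
    and sf: "sigma_finite_measure N"
    and inv: "\<And>a. distr N (lborel_on I) (translate_on I a) = N"
    and S [measurable]: "S \<in> sets (lborel_on I)"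
  shows "emeasure N S = emeasure (lborel_on I) S * emeasure N (I \<rightarrow>\<^sub>E {0..<1})"
proof -
  let ?L = "lborel_on I"
  define F where "F = (I \<rightarrow>\<^sub>E {-1<..(0::real)})"
  define neg where "neg = (\<lambda>y::'a \<Rightarrow> real. \<lambda>i\<in>I. - y i)"
  have spN: "space N = I \<rightarrow>\<^sub>E UNIV"
    using sets_eq_imp_space_eq[OF sets_N] by (simp add: space_PiM)
  have F [measurable]: "F \<in> sets ?L"
    unfolding F_def using I by (intro sets_PiM_I_finite) auto
  have neg [measurable]: "neg \<in> ?L \<rightarrow>\<^sub>M ?L"
    unfolding neg_def by measurable
  have cube [measurable]: "(I \<rightarrow>\<^sub>E {0..<1}) \<in> sets ?L"
    using I by (intro sets_PiM_I_finite) auto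
  have F1: "emeasure ?L F = 1"
    unfolding F_def using I by (subst emeasure_lborel_on_box) auto
  interpret L: sigma_finite_measure ?L by (rule sigma_finite_lborel_on[OF I])
  interpret N: sigma_finite_measure N by (rule sf)
  interpret P: pair_sigma_finite ?L N ..
  have trN: "(\<integral>\<^sup>+ y. h (translate_on I a y) \<partial>N) = (\<integral>\<^sup>+ y. h y \<partial>N)"
    if [measurable]: "h \<in> borel_measurable ?L" for h a
    by (subst (2) inv[of a, symmetric]) (subst nn_integral_distr, auto)
  have trL: "(\<integral>\<^sup>+ y. h (translate_on I a y) \<partial>?L) = (\<integral>\<^sup>+ y. h y \<partial>?L)"
    if [measurable]: "h \<in> borel_measurable ?L" for h a
    by (subst (2) distr_lborel_on_translate[OF I, of a, symmetric]) (subst nn_integral_distr, auto)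
  let ?f = "indicator F :: _ \<Rightarrow> ennreal" and ?g = "indicator S :: _ \<Rightarrow> ennreal"
  have "emeasure N S = emeasure ?L F * emeasure N S"
    by (simp add: F1)
  also have "\<dots> = (\<integral>\<^sup>+ x. ?f x * emeasure N S \<partial>?L)"
    by (simp add: nn_integral_multc)
  also have "\<dots> = (\<integral>\<^sup>+ x. ?f x * (\<integral>\<^sup>+ y. ?g (translate_on I x y) \<partial>N) \<partial>?L)"
    by (subst trN) (auto simp: sets_N)
  also have "\<dots> = (\<integral>\<^sup>+ x. (\<integral>\<^sup>+ y. ?f x * ?g (translate_on I x y) \<partial>N) \<partial>?L)"
    by (subst nn_integral_cmult) auto
  also have "\<dots> = (\<integral>\<^sup>+ y. (\<integral>\<^sup>+ x. ?f x * ?g (translate_on I x y) \<partial>?L) \<partial>N)"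
    by (rule P.Fubini'[symmetric]) measurable
  \<comment> \<open>Invariance of Lebesgue measure replaces x by x - y, which frees the indicator of
    \<open>S\<close> from y. After the next exchange, invariance of \<open>N\<close> replaces y by x
    + y, which frees the indicator of \<open>F\<close> from x, and the double integral
    factors.\<close>
  also have "\<dots> = (\<integral>\<^sup>+ y. (\<integral>\<^sup>+ x. ?f (translate_on I (neg y) x) * ?g x \<partial>?L) \<partial>N)"
  proof (rule nn_integral_cong)
    fix y assume y: "y \<in> space N"
    then have [measurable]: "y \<in> space ?L" by (simp add: spN space_PiM)
    have "(\<integral>\<^sup>+ x. ?f x * ?g (translate_on I x y) \<partial>?L)
        = (\<integral>\<^sup>+ x. ?f (translate_on I (neg y) x) * ?g (translate_on I (translate_on I (neg y) x) y) \<partial>?L)"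
      by (rule trL[symmetric]) measurable
    also have "\<dots> = (\<integral>\<^sup>+ x. ?f (translate_on I (neg y) x) * ?g x \<partial>?L)"
    proof (rule nn_integral_cong)
      fix x assume x: "x \<in> space ?L"
      have "translate_on I (translate_on I (neg y) x) y = x"
        using x by (intro PiE_UNIV_eqI) (auto simp: neg_def space_PiM)
      then show "?f (translate_on I (neg y) x) * ?g (translate_on I (translate_on I (neg y) x) y)
        = ?f (translate_on I (neg y) x) * ?g x" by simp
    qed
    finally show "(\<integral>\<^sup>+ x. ?f x * ?g (translate_on I x y) \<partial>?L)
      = (\<integral>\<^sup>+ x. ?f (translate_on I (neg y) x) * ?g x \<partial>?L)" .
  qed
  also have "\<dots> = (\<integral>\<^sup>+ x. (\<integral>\<^sup>+ y. ?f (translate_on I (neg y) x) * ?g x \<partial>N) \<partial>?L)"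
    by (rule P.Fubini') measurable
  also have "\<dots> = (\<integral>\<^sup>+ x. ?g x * (\<integral>\<^sup>+ y. ?f (neg y) \<partial>N) \<partial>?L)"
  proof (rule nn_integral_cong)
    fix x assume x: "x \<in> space ?L"
    note [measurable] = x
    have "(\<integral>\<^sup>+ y. ?f (translate_on I (neg y) x) * ?g x \<partial>N)
        = (\<integral>\<^sup>+ y. ?f (translate_on I (neg (translate_on I x y)) x) * ?g x \<partial>N)"
      by (rule trN[symmetric]) measurable
    also have "\<dots> = (\<integral>\<^sup>+ y. ?f (neg y) * ?g x \<partial>N)"
    proof (rule nn_integral_cong)
      fix y
      have "translate_on I (neg (translate_on I x y)) x = neg y"
        by (intro PiE_UNIV_eqI[of _ I]) (auto simp: neg_def)
      then show "?f (translate_on I (neg (translate_on I x y)) x) * ?g x = ?f (neg y) * ?g x" by simp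
    qed
    also have "\<dots> = (\<integral>\<^sup>+ y. ?f (neg y) \<partial>N) * ?g x"
      by (rule nn_integral_multc) measurable
    finally show "(\<integral>\<^sup>+ y. ?f (translate_on I (neg y) x) * ?g x \<partial>N) = ?g x * (\<integral>\<^sup>+ y. ?f (neg y) \<partial>N)"
      by (simp add: mult.commute)
  qed
  also have "\<dots> = emeasure ?L S * (\<integral>\<^sup>+ y. ?f (neg y) \<partial>N)"
    by (simp add: nn_integral_multc)
  also have "(\<integral>\<^sup>+ y. ?f (neg y) \<partial>N) = (\<integral>\<^sup>+ y. indicator (I \<rightarrow>\<^sub>E {0..<1}) y \<partial>N)"
    by (intro nn_integral_cong) (auto simp: spN F_def neg_def indicator_def PiE_iff)
  also have "\<dots> = emeasure N (I \<rightarrow>\<^sub>E {0..<1})"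
    by (intro nn_integral_indicator) (simp add: sets_N)
  finally show ?thesis .
qed

text \<open>\<open>D\<close> and the unit cube \<open>Q\<close> are equidecomposable by countably
  many integer translations: \<open>X z\<close> is the part of \<open>Q\<close> that the shift by z
  moves into \<open>D\<close>, and \<open>Y z\<close> is its image. The sets \<open>X z\<close>
  partition \<open>Q\<close> by the hypothesis on \<open>D\<close>; the sets \<open>Y z\<close>
  partition \<open>D\<close> by taking integer parts.\<close>

lemma emeasure_fundamental_domain:
  assumes I: "finite I" and D [measurable]: "D \<in> sets (lborel_on I)"
    and D1: "\<And>x. x \<in> I \<rightarrow>\<^sub>E UNIV \<Longrightarrow> \<exists>!z. z \<in> I \<rightarrow>\<^sub>E \<int> \<and> translate_on I z x \<in> D"
  shows "emeasure (lborel_on I) D = 1"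
proof -
  let ?L = "lborel_on I"
  define Z where "Z = (I \<rightarrow>\<^sub>E (\<int>::real set))"
  define Q where "Q = (I \<rightarrow>\<^sub>E {0..<(1::real)})"
  have [measurable]: "Q \<in> sets ?L"
    unfolding Q_def using I by (intro sets_PiM_I_finite) auto
  have Q1: "emeasure ?L Q = 1"
    unfolding Q_def using I by (subst emeasure_lborel_on_box) auto
  have "countable (\<int>::real set)"
    unfolding Ints_def by simp
  then have cZ [simp]: "countable Z"
    unfolding Z_def using I by (intro countable_PiE) auto
  define neg where "neg = (\<lambda>y::'a \<Rightarrow> real. \<lambda>i\<in>I. - y i)"
  define X where "X = (\<lambda>z. {x \<in> space ?L. translate_on I z x \<in> D \<and> x \<in> Q})"
  define Y where "Y = (\<lambda>z. {x \<in> space ?L. x \<in> D \<and> translate_on I (neg z) x \<in> Q})"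
  have [measurable]: "X z \<in> sets ?L" "Y z \<in> sets ?L" for z
    unfolding X_def Y_def by measurable
  have dX: "disjoint_family_on X Z"
    using D1 by (auto simp: disjoint_family_on_def X_def Z_def space_PiM)
  have frac: "y i = z i"
    if "x \<in> I \<rightarrow>\<^sub>E UNIV" "z \<in> Z" "y \<in> Z" "i \<in> I"
      "translate_on I (neg z) x \<in> Q" "translate_on I (neg y) x \<in> Q" for x y z i
  proof -
    have "z i \<in> \<int>" "y i \<in> \<int>" using that by (auto simp: Z_def)
    then obtain a b where ab: "z i = of_int a" "y i = of_int b" by (auto elim!: Ints_cases)
    have "0 \<le> x i - z i" "x i - z i < 1" "0 \<le> x i - y i" "x i - y i < 1"
      using that(4) PiE_mem[OF that(5)[unfolded Q_def], of i] PiE_mem[OF that(6)[unfolded Q_def], of i]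
      by (auto simp: neg_def)
    then have "\<bar>z i - y i\<bar> < 1" by linarith
    then show ?thesis using ab by (simp flip: of_int_diff of_int_abs)
  qed
  have dY: "disjoint_family_on Y Z"
  proof (unfold disjoint_family_on_def, intro ballI impI)
    fix z y assume zy: "z \<in> Z" "y \<in> Z" "z \<noteq> y"
    show "Y z \<inter> Y y = {}"
    proof (rule ccontr)
      assume "Y z \<inter> Y y \<noteq> {}"
      then obtain x where x: "x \<in> Y z" "x \<in> Y y" by auto
      have "z = y"
        using zy frac[of x z y] x
        by (intro PiE_UNIV_eqI[of _ I]) (auto simp: Z_def Y_def space_PiM)
      then show False using zy by simp
    qed
  qed
  have XQ: "\<Union>(X ` Z) = Q"
  proof
    show "Q \<subseteq> \<Union>(X ` Z)"
    proof
      fix x assume x: "x \<in> Q"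
      then have "x \<in> I \<rightarrow>\<^sub>E UNIV" by (auto simp: Q_def)
      then show "x \<in> \<Union>(X ` Z)" using D1[of x] x by (auto simp: X_def Z_def space_PiM)
    qed
  qed (auto simp: X_def)
  have DI: "D \<subseteq> I \<rightarrow>\<^sub>E UNIV" using sets.sets_into_space[OF D] by (simp add: space_PiM)
  have YD: "\<Union>(Y ` Z) = D"
  proof
    show "D \<subseteq> \<Union>(Y ` Z)"
    proof
      fix x assume x: "x \<in> D"
      let ?z = "\<lambda>i\<in>I. real_of_int \<lfloor>x i\<rfloor>"
      have "?z \<in> Z" by (auto simp: Z_def)
      moreover have "translate_on I (neg ?z) x \<in> Q"
        by (auto simp: Q_def neg_def translate_on_def PiE_iff) linarith+
      ultimately show "x \<in> \<Union>(Y ` Z)" using x DI by (auto simp: Y_def space_PiM)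
    qed
  qed (auto simp: Y_def)
  have XY: "emeasure ?L (X z) = emeasure ?L (Y z)" if "z \<in> Z" for z
  proof -
    have "X z = translate_on I z -` Y z \<inter> space ?L"
    proof -
      have "translate_on I (neg z) (translate_on I z x) = x" if "x \<in> space ?L" for x
        using that by (intro PiE_UNIV_eqI[of _ I]) (auto simp: neg_def space_PiM)
      then show ?thesis by (auto simp: X_def Y_def)
    qed
    then have "emeasure ?L (X z) = emeasure (distr ?L ?L (translate_on I z)) (Y z)"
      by (simp add: emeasure_distr)
    then show ?thesis by (simp add: distr_lborel_on_translate[OF I])
  qed
  have "emeasure ?L D = (\<integral>\<^sup>+ z. emeasure ?L (Y z) \<partial>count_space Z)"
    unfolding YD[symmetric] by (rule emeasure_UN_countable[OF _ cZ dY]) simp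
  also have "\<dots> = (\<integral>\<^sup>+ z. emeasure ?L (X z) \<partial>count_space Z)"
    by (intro nn_integral_cong) (simp add: XY)
  also have "\<dots> = emeasure ?L (\<Union>(X ` Z))"
    by (rule emeasure_UN_countable[OF _ cZ dX, symmetric]) simp
  finally show ?thesis by (simp add: XQ Q1)
qed

section \<open>Independence of the lattice basis\<close>

text \<open>Row i of \<open>B\<close> holds the coordinates of the image of the i-th unit vector.
  Invertibility is not built in; it is expressed by a second map of the same form.\<close>

definition integer_affine_map ::
    "'a set \<Rightarrow> ('a \<Rightarrow> int) \<Rightarrow> ('a \<Rightarrow> 'a \<Rightarrow> int) \<Rightarrow> ('a \<Rightarrow> real) \<Rightarrow> 'a \<Rightarrow> real" where
  "integer_affine_map I c B t = (\<lambda>j\<in>I. of_int (c j) + (\<Sum>i\<in>I. t i * of_int (B i j)))"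

lemma integer_affine_map_apply [simp]:
  "j \<in> I \<Longrightarrow> integer_affine_map I c B t j = of_int (c j) + (\<Sum>i\<in>I. t i * of_int (B i j))"
  by (simp add: integer_affine_map_def)

lemma integer_affine_map_in [simp]: "integer_affine_map I c B t \<in> I \<rightarrow>\<^sub>E UNIV"
  by (simp add: integer_affine_map_def)

lemma measurable_integer_affine_map [measurable]:
  "integer_affine_map I c B \<in> lborel_on I \<rightarrow>\<^sub>M lborel_on I"
  unfolding integer_affine_map_def[abs_def] by measurable

lemma integer_affine_map_translate:
  "integer_affine_map I c B (translate_on I a t) =
   translate_on I (\<lambda>j. \<Sum>i\<in>I. a i * of_int (B i j)) (integer_affine_map I c B t)"
  by (rule PiE_UNIV_eqI[of _ I]) (auto simp: sum.distrib algebra_simps)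

text \<open>An affine automorphism of \<open>\<int>\<^sup>I\<close> pulls the unit cube back to a fundamental domain of \<open>\<int>\<^sup>I\<close>.\<close>

lemma emeasure_integer_affine_map_vimage:
  assumes I: "finite I"
    and inv1: "\<And>t. t \<in> I \<rightarrow>\<^sub>E UNIV \<Longrightarrow> integer_affine_map I c' B' (integer_affine_map I c B t) = t"
    and inv2: "\<And>t. t \<in> I \<rightarrow>\<^sub>E UNIV \<Longrightarrow> integer_affine_map I c B (integer_affine_map I c' B' t) = t"
    and S [measurable]: "S \<in> sets (lborel_on I)"
  shows "emeasure (lborel_on I) (integer_affine_map I c B -` S \<inter> space (lborel_on I))
       = emeasure (lborel_on I) S"
proof -
  let ?L = "lborel_on I"
  let ?T = "integer_affine_map I c B" and ?T' = "integer_affine_map I c' B'"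
  let ?Q = "I \<rightarrow>\<^sub>E {0..<(1::real)}"
  have Q [measurable]: "?Q \<in> sets ?L"
    using I by (intro sets_PiM_I_finite) auto
  define N where "N = distr ?L ?L ?T"
  have sets_N [measurable_cong]: "sets N = sets ?L" by (simp add: N_def)
  \<comment> \<open>The image of \<open>N\<close> under the inverse map is Lebesgue measure, and
    sigma-finiteness of an image measure passes back to \<open>N\<close>.\<close>
  have "distr N ?L ?T' = distr ?L ?L (?T' \<circ> ?T)"
    unfolding N_def by (rule distr_distr) auto
  also have "\<dots> = distr ?L ?L id"
    by (rule distr_cong) (auto simp: inv1 space_PiM)
  also have "\<dots> = ?L" by (simp add: id_def)
  finally have "sigma_finite_measure (distr N ?L ?T')"
    using sigma_finite_lborel_on[OF I] by simp
  then have sf: "sigma_finite_measure N"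
    by (rule sigma_finite_measure_distr) measurable
  have trans: "distr N ?L (translate_on I a) = N" for a
  proof -
    \<comment> \<open>The image of \<open>a\<close> under the linear part of \<open>?T'\<close>:
      translating by \<open>?b\<close> before \<open>?T\<close> is the same as translating by
      \<open>a\<close> after it.\<close>
    let ?b = "\<lambda>j. \<Sum>i\<in>I. a i * of_int (B' i j)"
    have comm: "translate_on I a (?T t) = ?T (translate_on I ?b t)" if t: "t \<in> I \<rightarrow>\<^sub>E UNIV" for t
    proof -
      have "?T' (translate_on I a (?T t)) = translate_on I ?b t"
        using integer_affine_map_translate[of I c' B' a "?T t"] inv1[OF t] by simp
      then show ?thesis
        using inv2[of "translate_on I a (?T t)"] by simp
    qed
    have "distr N ?L (translate_on I a) = distr ?L ?L (translate_on I a \<circ> ?T)"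
      unfolding N_def by (rule distr_distr) auto
    also have "\<dots> = distr ?L ?L (?T \<circ> translate_on I ?b)"
      by (rule distr_cong) (auto simp: comm space_PiM)
    also have "\<dots> = distr (distr ?L ?L (translate_on I ?b)) ?L ?T"
      by (rule distr_distr[symmetric]) auto
    also have "\<dots> = N" by (simp add: distr_lborel_on_translate[OF I] N_def)
    finally show ?thesis .
  qed
  have "emeasure ?L (?T -` ?Q \<inter> space ?L) = 1"
  proof (rule emeasure_fundamental_domain[OF I])
    show "?T -` ?Q \<inter> space ?L \<in> sets ?L" by measurable
    fix x :: "'a \<Rightarrow> real" assume x: "x \<in> I \<rightarrow>\<^sub>E UNIV"
    \<comment> \<open>The only integer shift that brings \<open>?T x\<close> into the cube subtracts
      its floors; \<open>z\<close> is that shift carried back by the linear part of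
      \<open>?T'\<close>, hence an integer vector.\<close>
    define z where "z = (\<lambda>j\<in>I. \<Sum>i\<in>I. - real_of_int \<lfloor>?T x i\<rfloor> * of_int (B' i j))"
    have zx: "translate_on I z x = ?T' (translate_on I (\<lambda>i. - real_of_int \<lfloor>?T x i\<rfloor>) (?T x))"
      unfolding integer_affine_map_translate inv1[OF x] 
      by (rule PiE_UNIV_eqI[of _ I]) (auto simp: z_def)
    show "\<exists>!z. z \<in> I \<rightarrow>\<^sub>E \<int> \<and> translate_on I z x \<in> ?T -` ?Q \<inter> space ?L"
    proof (rule ex1I[of _ z], intro conjI)
      show "z \<in> I \<rightarrow>\<^sub>E \<int>"
        by (auto simp: z_def intro!: Ints_sum Ints_mult Ints_minus)
      have "?T (translate_on I z x) = translate_on I (\<lambda>i. - real_of_int \<lfloor>?T x i\<rfloor>) (?T x)"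
        unfolding zx by (rule inv2) simp
      also have "\<dots> \<in> ?Q"
        by (auto simp: translate_on_def PiE_iff) linarith+
      finally show "translate_on I z x \<in> ?T -` ?Q \<inter> space ?L" by simp
    next
      fix y assume y: "y \<in> I \<rightarrow>\<^sub>E \<int> \<and> translate_on I y x \<in> ?T -` ?Q \<inter> space ?L"
      have y': "?T (translate_on I y x) = ?T (translate_on I z x)"
      proof (rule PiE_UNIV_eqI[of _ I])
        fix j assume j: "j \<in> I"
        have "y i \<in> \<int>" if "i \<in> I" for i using y that by auto
        then have "(\<Sum>i\<in>I. y i * of_int (B i j)) \<in> \<int>"
          by (intro Ints_sum Ints_mult) auto
        then obtain m where m: "(\<Sum>i\<in>I. y i * of_int (B i j)) = real_of_int m" by (elim Ints_cases)
        have "?T (translate_on I y x) j = of_int m + ?T x j"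
          using j by (subst integer_affine_map_translate) (simp add: m)
        moreover have "?T (translate_on I y x) j \<in> {0..<1}"
          using y j by (auto dest!: PiE_mem)
        moreover from calculation have "\<lfloor>?T x j\<rfloor> = - m"
          by (intro floor_unique) (simp_all del: integer_affine_map_apply)
        ultimately have "?T (translate_on I y x) j = - real_of_int \<lfloor>?T x j\<rfloor> + ?T x j"
          by (simp del: integer_affine_map_apply)
        also have "\<dots> = ?T (translate_on I z x) j"
        proof -
          have "?T (translate_on I z x) = translate_on I (\<lambda>i. - real_of_int \<lfloor>?T x i\<rfloor>) (?T x)"
            unfolding zx by (rule inv2) simp
          then show ?thesis using j by (simp del: integer_affine_map_apply)
        qed
        finally show "?T (translate_on I y x) j = ?T (translate_on I z x) j" .
      qed auto
      then have "translate_on I y x = translate_on I z x"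
        by (metis inv1 translate_on_in)
      then have "y i = z i" if "i \<in> I" for i
        using that by (metis add_right_cancel translate_on_apply)
      then show "y = z"
        using y by (intro PiE_UNIV_eqI[of _ I]) (auto simp: z_def)
    qed
  qed
  then have "emeasure N ?Q = 1"
    by (simp add: N_def emeasure_distr)
  then have "emeasure N S = emeasure ?L S"
    using translation_invariant_eq_lborel_on[OF I sets_N sf trans S] by simp
  then show ?thesis
    by (simp add: N_def emeasure_distr)
qed

section \<open>Change of lattice basis and well-definedness of the normalized volume\<close>

lemma affine_lattice_basis_mem:
  "affine_lattice_basis A p d v \<Longrightarrow> p + (\<Sum>i<d. t i *\<^sub>R v i) \<in> A"
  by (auto simp: affine_lattice_basis_def)

lemma affine_lattice_basis_inj:
  assumes "affine_lattice_basis A p d v"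
    and "s \<in> {..<d} \<rightarrow>\<^sub>E UNIV" "t \<in> {..<d} \<rightarrow>\<^sub>E UNIV"
    and eq: "p + (\<Sum>i<d. s i *\<^sub>R v i) = p + (\<Sum>i<d. t i *\<^sub>R v i)"
  shows "s = t"
proof (rule PiE_UNIV_eqI[OF assms(2,3)])
  fix i assume i: "i \<in> {..<d}"
  have inj: "inj_on v {..<d}" and ind: "independent (v ` {..<d})"
    using assms(1) by (auto simp: affine_lattice_basis_def)
  let ?u = "\<lambda>w. s (inv_into {..<d} v w) - t (inv_into {..<d} v w)"
  have "(\<Sum>w\<in>v ` {..<d}. ?u w *\<^sub>R w) = (\<Sum>i<d. (s i - t i) *\<^sub>R v i)"
    by (subst sum.reindex[OF inj]) (auto simp: inv_into_f_f[OF inj] intro!: sum.cong)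
  also have "\<dots> = 0"
    using eq by (simp add: scaleR_diff_left sum_subtractf)
  finally have "(\<Sum>w\<in>v ` {..<d}. ?u w *\<^sub>R w) = 0" .
  from independentD[OF ind finite_imageI[OF finite_lessThan] subset_refl this imageI[OF i]]
  have "?u (v i) = 0" .
  then show "s i = t i" using i by (simp add: inv_into_f_f[OF inj])
qed

text \<open>Each \<open>v i\<close> is the difference of the points \<open>p + v i\<close> and
  \<open>p\<close> of \<open>A\<close>, and all such differences are combinations of the
  \<open>w j\<close>. Applied both ways, both spans are the direction space of
  \<open>A\<close>.\<close>

lemma affine_lattice_basis_span_subset:
  assumes v: "affine_lattice_basis A p d v" and w: "affine_lattice_basis A q e w"
  shows "span (v ` {..<d}) \<subseteq> span (w ` {..<e})"
proof (rule span_minimal)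
  have diff: "x - y \<in> span (w ` {..<e})" if "x \<in> A" "y \<in> A" for x y
  proof -
    have "A = range (\<lambda>t. q + (\<Sum>i<e. t i *\<^sub>R w i))"
      using w by (simp add: affine_lattice_basis_def)
    then have "x \<in> range (\<lambda>t. q + (\<Sum>i<e. t i *\<^sub>R w i))"
      "y \<in> range (\<lambda>t. q + (\<Sum>i<e. t i *\<^sub>R w i))"
      using that by simp_all
    then obtain s t where "x = q + (\<Sum>i<e. s i *\<^sub>R w i)" "y = q + (\<Sum>i<e. t i *\<^sub>R w i)"
      by (elim rangeE)
    then have "x - y = (\<Sum>i<e. s i *\<^sub>R w i) - (\<Sum>i<e. t i *\<^sub>R w i)" by simp
    also have "\<dots> \<in> span (w ` {..<e})"
      by (intro span_diff span_sum span_scale span_base) auto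
    finally show ?thesis .
  qed
  show "v ` {..<d} \<subseteq> span (w ` {..<e})"
  proof
    fix x assume "x \<in> v ` {..<d}"
    then obtain i where i: "i < d" "x = v i" by auto
    have "(\<Sum>j<d. (if j = i then 1 else 0) *\<^sub>R v j) = (\<Sum>j<d. if j = i then v j else 0)"
      by (rule sum.cong) auto
    then have "p + v i \<in> A"
      using affine_lattice_basis_mem[OF v, of "\<lambda>j. if j = i then 1 else 0"] i by simp
    moreover have "p \<in> A"
      using affine_lattice_basis_mem[OF v, of "\<lambda>_. 0"] by simp
    ultimately show "x \<in> span (w ` {..<e})"
      using diff[of "p + v i" p] i by simp
  qed
qed simp

lemma affine_lattice_basis_dim_unique:
  assumes v: "affine_lattice_basis A p d v" and w: "affine_lattice_basis A q e w"
  shows "d = e"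
proof -
  have "span (v ` {..<d}) = span (w ` {..<e})"
    using affine_lattice_basis_span_subset[OF v w] affine_lattice_basis_span_subset[OF w v] by blast
  then have "card (v ` {..<d}) = card (w ` {..<e})"
    using v w unfolding affine_lattice_basis_def by (metis real_vector.dim_eq_card)
  then show ?thesis
    using v w by (simp add: affine_lattice_basis_def card_image)
qed

text \<open>The points \<open>p\<close> and \<open>p + v i\<close> are lattice points of
  \<open>A\<close>, so their coordinates with respect to \<open>w\<close> are integers. Those of
  \<open>p\<close> give \<open>c\<close>; subtracting them from those of \<open>p + v i\<close>
  gives row i of \<open>B\<close>.\<close>

lemma affine_lattice_basis_transition:
  assumes v: "affine_lattice_basis A p d v" and w: "affine_lattice_basis A q d w"
  shows "\<exists>c B. \<forall>t. p + (\<Sum>i<d. t i *\<^sub>R v i) =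
    q + (\<Sum>j<d. integer_affine_map {..<d} c B t j *\<^sub>R w j)"
proof -
  have vL: "A \<inter> lattice_points = range (\<lambda>z. p + (\<Sum>i<d. real_of_int (z i) *\<^sub>R v i))"
    and wL: "A \<inter> lattice_points = range (\<lambda>z. q + (\<Sum>i<d. real_of_int (z i) *\<^sub>R w i))"
    using v w by (auto simp: affine_lattice_basis_def)
  have coord: "\<exists>c. p + (\<Sum>i<d. real_of_int (z i) *\<^sub>R v i) = q + (\<Sum>j<d. real_of_int (c j) *\<^sub>R w j)" for z
  proof -
    have "p + (\<Sum>i<d. real_of_int (z i) *\<^sub>R v i) \<in> range (\<lambda>z. q + (\<Sum>i<d. real_of_int (z i) *\<^sub>R w i))"
      using vL wL by blast
    then show ?thesis by auto
  qed
  obtain c where c: "p = q + (\<Sum>j<d. real_of_int (c j) *\<^sub>R w j)"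
    using coord[of "\<lambda>_. 0"] by auto
  have "\<exists>b. p + v i = q + (\<Sum>j<d. real_of_int (b j) *\<^sub>R w j)" if "i < d" for i
  proof -
    have "(\<Sum>j<d. real_of_int (if j = i then 1 else 0) *\<^sub>R v j) = (\<Sum>j<d. if j = i then v j else 0)"
      by (rule sum.cong) auto
    then show ?thesis using coord[of "\<lambda>j. if j = i then 1 else 0"] that by simp
  qed
  then obtain b where b: "\<And>i. i < d \<Longrightarrow> p + v i = q + (\<Sum>j<d. real_of_int (b i j) *\<^sub>R w j)"
    by metis
  define B where "B = (\<lambda>i j. b i j - c j)"
  have vi: "v i = (\<Sum>j<d. real_of_int (B i j) *\<^sub>R w j)" if "i < d" for i
    using b[OF that] unfolding c by (simp add: B_def scaleR_diff_left sum_subtractf algebra_simps)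
  show ?thesis
  proof (rule exI[of _ c], rule exI[of _ B], rule allI)
    fix t :: "nat \<Rightarrow> real"
    have "(\<Sum>i<d. t i *\<^sub>R v i) = (\<Sum>i<d. \<Sum>j<d. (t i * of_int (B i j)) *\<^sub>R w j)"
      by (intro sum.cong) (auto simp: vi scaleR_sum_right)
    also have "\<dots> = (\<Sum>j<d. (\<Sum>i<d. t i * of_int (B i j)) *\<^sub>R w j)"
      by (subst sum.swap) (simp add: scaleR_sum_left)
    finally have "p + (\<Sum>i<d. t i *\<^sub>R v i) =
      q + ((\<Sum>j<d. real_of_int (c j) *\<^sub>R w j) + (\<Sum>j<d. (\<Sum>i<d. t i * of_int (B i j)) *\<^sub>R w j))"
      by (subst c) (simp add: add.assoc)
    also have "(\<Sum>j<d. real_of_int (c j) *\<^sub>R w j) + (\<Sum>j<d. (\<Sum>i<d. t i * of_int (B i j)) *\<^sub>R w j)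
      = (\<Sum>j<d. integer_affine_map {..<d} c B t j *\<^sub>R w j)"
      by (simp add: sum.distrib[symmetric] scaleR_add_left)
    finally show "p + (\<Sum>i<d. t i *\<^sub>R v i) =
      q + (\<Sum>j<d. integer_affine_map {..<d} c B t j *\<^sub>R w j)" .
  qed
qed

text \<open>The transition maps in the two directions are mutually inverse since coordinates are
  unique, so they are automorphisms of the integer lattice and preserve Lebesgue measure.\<close>

lemma measure_lattice_coordinates_unique:
  assumes v: "affine_lattice_basis A p d v" and w: "affine_lattice_basis A q d w"
  shows "measure (lborel_on {..<d}) {t \<in> {..<d} \<rightarrow>\<^sub>E UNIV. p + (\<Sum>i<d. t i *\<^sub>R v i) \<in> P} =
         measure (lborel_on {..<d}) {t \<in> {..<d} \<rightarrow>\<^sub>E UNIV. q + (\<Sum>i<d. t i *\<^sub>R w i) \<in> P}"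
    (is "measure ?L ?X = measure ?L ?Y")
proof -
  obtain c B where T: "\<And>t. p + (\<Sum>i<d. t i *\<^sub>R v i) =
      q + (\<Sum>j<d. integer_affine_map {..<d} c B t j *\<^sub>R w j)"
    using affine_lattice_basis_transition[OF v w] by metis
  obtain c' B' where T': "\<And>t. q + (\<Sum>i<d. t i *\<^sub>R w i) =
      p + (\<Sum>j<d. integer_affine_map {..<d} c' B' t j *\<^sub>R v j)"
    using affine_lattice_basis_transition[OF w v] by metis
  let ?T = "integer_affine_map {..<d} c B" and ?T' = "integer_affine_map {..<d} c' B'"
  have inv1: "?T' (?T t) = t" if "t \<in> {..<d} \<rightarrow>\<^sub>E UNIV" for t
    by (rule affine_lattice_basis_inj[OF v integer_affine_map_in that trans[OF T'[symmetric] T[symmetric]]])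
  have inv2: "?T (?T' t) = t" if "t \<in> {..<d} \<rightarrow>\<^sub>E UNIV" for t
    by (rule affine_lattice_basis_inj[OF w integer_affine_map_in that trans[OF T[symmetric] T'[symmetric]]])
  define Pv where "Pv t \<longleftrightarrow> p + (\<Sum>i<d. t i *\<^sub>R v i) \<in> P" for t
  define Pw where "Pw t \<longleftrightarrow> q + (\<Sum>i<d. t i *\<^sub>R w i) \<in> P" for t
  have PvT: "Pv t = Pw (?T t)" and PwT': "Pw t = Pv (?T' t)" for t
    unfolding Pv_def Pw_def by (simp_all only: T[of t] T'[of t])
  have X: "?X = ?T -` ?Y \<inter> space ?L"
    unfolding Pv_def[symmetric] Pw_def[symmetric] space_PiM space_lborel
    by (intro set_eqI) (simp add: PvT conj_commute)
  have Y: "?Y = ?T' -` ?X \<inter> space ?L"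
    unfolding Pv_def[symmetric] Pw_def[symmetric] space_PiM space_lborel
    by (intro set_eqI) (simp add: PwT' conj_commute)
  show ?thesis
  proof (cases "?Y \<in> sets ?L")
    case True
    then show ?thesis
      using emeasure_integer_affine_map_vimage[OF finite_lessThan inv1 inv2 True]
      by (simp only: X[symmetric] measure_def)
  next
    \<comment> \<open>\<open>P\<close> is arbitrary. Non-measurability transfers from
      \<open>?Y\<close> to \<open>?X\<close> because each set is a preimage of the other, and then
      both measures have the default value 0.\<close>
    case False
    then have "?X \<notin> sets ?L"
      using measurable_sets[OF measurable_integer_affine_map, of ?X "{..<d}" c' B'] Y by metis
    with False show ?thesis by (simp only: measure_notin_sets not_False_eq_True)
  qed
qed

theorem normalized_volume_eq:
  assumes v: "affine_lattice_basis (affine hull P) p d v"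
  shows "normalized_volume P = fact d * measure (lborel_on {..<d})
    {t \<in> {..<d} \<rightarrow>\<^sub>E UNIV. p + (\<Sum>i<d. t i *\<^sub>R v i) \<in> P}"
  unfolding normalized_volume_def
proof (rule the_equality)
  fix x
  assume "\<exists>p d v. affine_lattice_basis (affine hull P) p d v \<and>
    x = fact d * measure (lborel_on {..<d}) {t \<in> {..<d} \<rightarrow>\<^sub>E UNIV. p + (\<Sum>i<d. t i *\<^sub>R v i) \<in> P}"
  then obtain q e w where w: "affine_lattice_basis (affine hull P) q e w"
    and x: "x = fact e * measure (lborel_on {..<e}) {t \<in> {..<e} \<rightarrow>\<^sub>E UNIV. q + (\<Sum>i<e. t i *\<^sub>R w i) \<in> P}"
    by blast
  have e: "e = d" by (rule affine_lattice_basis_dim_unique[OF w v])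
  show "x = fact d * measure (lborel_on {..<d})
    {t \<in> {..<d} \<rightarrow>\<^sub>E UNIV. p + (\<Sum>i<d. t i *\<^sub>R v i) \<in> P}"
    using measure_lattice_coordinates_unique[OF w[unfolded e] v, of P] unfolding x e by simp
qed (intro exI conjI, rule v, rule refl)

section \<open>Volumes of truncated simplices\<close>

text \<open>Read the coordinates as the successive gaps between \<open>card I\<close> sorted points
  of [0, r + s], the gaps of \<open>C\<close> first. The condition on \<open>C\<close> says that at
  least \<open>card C\<close> points lie in [0, r]; the i-th summand counts the unsorted
  configurations with exactly i such points, and the factorial accounts for sorting. The proof
  obtains the same sum by integrating out the coordinates of \<open>C\<close> one at a time. Both
  relations are covered since the pieces are cut off by strict inequalities and their complements by
  weak ones.\<close>

lemma emeasure_truncated_simplex: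
  fixes R :: "real \<Rightarrow> real \<Rightarrow> bool"
  assumes R: "R = (<) \<or> R = (\<le>)"
    and "finite I" "C \<subseteq> I" "r > 0" and s: "s \<ge> 0"
  shows "emeasure (lborel_on I)
      {t \<in> I \<rightarrow>\<^sub>E UNIV. (\<forall>i\<in>I. 0 \<le> t i) \<and> R (sum t C) r \<and> sum t I \<le> r + s} =
    ennreal ((\<Sum>i=card C..card I. real (card I choose i) * r ^ i * s ^ (card I - i)) / fact (card I))"
proof -
  define X where "X = (\<lambda>(C :: 'a set) W r. {t \<in> space (lborel_on (C \<union> W)). (\<forall>i\<in>C \<union> W. 0 \<le> t i) \<and>
    R (sum t C) r \<and> sum t (C \<union> W) \<le> r + s})"
  define g where "g = (\<lambda>c m r. (\<Sum>i=c..m. real (m choose i) * r ^ i * s ^ (m - i)) / fact m)"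
  have g0: "0 \<le> g c m r" if "r \<ge> 0" for c m r
    using that s by (auto simp: g_def intro!: sum_nonneg divide_nonneg_nonneg)
  interpret product_sigma_finite "\<lambda>_::'a. lborel :: real measure"
    by standard
  have meas [measurable]: "X C W r \<in> sets (lborel_on (C \<union> W))" if "finite C" "finite W" for C W r
  proof -
    note fin [simp] = that
    show ?thesis
      using R unfolding X_def by (elim disjE) (simp_all, measurable)
  qed
  have main: "emeasure (lborel_on (C \<union> W)) (X C W r) = ennreal (g (card C) (card (C \<union> W)) r)"
    if "finite C" "finite W" "C \<inter> W = {}" "r > 0" for C W :: "'a set" and r
    using that
  proof (induction C arbitrary: r rule: finite_induct)
    case (empty r)
    have "X {} W r = {x. (\<forall>i\<in>W. 0 \<le> x i) \<and> sum x W \<le> r + s} \<inter> space (lborel_on W)"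
      using R empty by (auto simp: X_def)
    then have "emeasure (lborel_on W) (X {} W r) = ennreal ((r + s) ^ card W / fact (card W))"
      using emeasure_std_simplex_aux[OF empty(1), of "r + s"] empty s by simp
    then show ?case
      by (simp add: g_def binomial_ring atLeast0AtMost)
  next
    case (insert b C r)
    let ?I = "C \<union> W"
    define m where "m = card ?I"
    define c where "c = card C"
    have fin [simp]: "finite C" "finite W" "finite ?I" and b: "b \<notin> C" "b \<notin> W" "b \<notin> ?I"
      and disj: "C \<inter> W = {}" and r: "r > 0"
      using insert by auto
    have cm: "card (insert b C \<union> W) = Suc m" "card (insert b C) = Suc c"
      using b by (auto simp: m_def c_def)
    have cle: "c \<le> m" unfolding c_def m_def by (intro card_mono) auto
    have [measurable]: "X (insert b C) W r \<in> sets (lborel_on (insert b ?I))"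
      using meas[of "insert b C" W r] by simp
    \<comment> \<open>Fixing coordinate \<open>b\<close> at y lowers both bounds by y, so only
      \<open>r\<close> changes and \<open>s\<close> stays. This is why the total bound is written r
      + s.\<close>
    have step: "x(b := y) \<in> X (insert b C) W r \<longleftrightarrow> 0 \<le> y \<and> x \<in> X C W (r - y)"
      if x: "x \<in> space (lborel_on ?I)" for x y
    proof -
      have sp: "x(b := y) \<in> space (lborel_on (insert b ?I))"
        using x by (auto simp: space_PiM PiE_iff extensional_def)
      have "sum (x(b := y)) (insert b A) = y + sum x A" if "finite A" "b \<notin> A" for A
        using that by (simp add: sum.insert) (rule sum.cong, auto)
      then have sums: "sum (x(b := y)) (insert b C) = y + sum x C"
        "sum (x(b := y)) (insert b ?I) = y + sum x ?I"
        using b by auto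
      have Rr: "R (y + sum x C) r \<longleftrightarrow> R (sum x C) (r - y)"
        using R by auto
      have pos: "(\<forall>i\<in>insert b ?I. 0 \<le> (x(b := y)) i) \<longleftrightarrow> 0 \<le> y \<and> (\<forall>i\<in>?I. 0 \<le> x i)"
        using b by auto
      have le: "y + sum x ?I \<le> r + s \<longleftrightarrow> sum x ?I \<le> r - y + s"
        by linarith
      show ?thesis
        by (simp only: X_def mem_Collect_eq Un_insert_left sp sums Rr pos le x simp_thms conj_assoc)
    qed
    have empty: "X C W (r - y) = {}" if "y > r" for y
    proof -
      have "\<not> R (sum x C) (r - y)" if "\<forall>i\<in>?I. 0 \<le> x i" for x
        using sum_nonneg[of C x] that \<open>y > r\<close> R by fastforce
      then show ?thesis by (auto simp: X_def)
    qed
    have "emeasure (lborel_on (insert b ?I)) (X (insert b C) W r) =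
      (\<integral>\<^sup>+ x. indicator (X (insert b C) W r) x \<partial>lborel_on (insert b ?I))"
      by (subst nn_integral_indicator) auto
    also have "\<dots> = (\<integral>\<^sup>+ y. (\<integral>\<^sup>+ x. indicator (X (insert b C) W r) (x(b := y)) \<partial>lborel_on ?I) \<partial>lborel)"
      using b by (intro product_nn_integral_insert_rev) auto
    also have "\<dots> = (\<integral>\<^sup>+ y. (\<integral>\<^sup>+ x. indicator {0..} y * indicator (X C W (r - y)) x \<partial>lborel_on ?I) \<partial>lborel)"
      using step by (intro nn_integral_cong) (auto simp: indicator_def)
    also have "\<dots> = (\<integral>\<^sup>+ y. indicator {0..} y * emeasure (lborel_on ?I) (X C W (r - y)) \<partial>lborel)"
      by (intro nn_integral_cong, subst nn_integral_cmult) auto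
    also have "\<dots> = (\<integral>\<^sup>+ y. ennreal (g c m (r - y)) * indicator {0..r} y \<partial>lborel)"
    proof (rule nn_integral_cong_AE)
      \<comment> \<open>The induction hypothesis needs r - y > 0; the single point y = r is
        discarded as a null set.\<close>
      show "AE y in lborel. indicator {0..} y * emeasure (lborel_on ?I) (X C W (r - y)) =
        ennreal (g c m (r - y)) * indicator {0..r} y"
        using AE_lborel_singleton[of r]
      proof eventually_elim
        case (elim y)
        show ?case
        proof (cases "y < r")
          case True
          then show ?thesis
            using insert.IH[of "r - y"] disj by (auto simp: indicator_def c_def m_def)
        next
          case False
          then show ?thesis using elim empty[of y] by (auto simp: indicator_def)
        qed
      qed
    qed
    also have "\<dots> = ennreal (g (Suc c) (Suc m) r)"
    proof -
      \<comment> \<open>The claimed formula, with sign reversed, as a function of the remaining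
        bound r - y: its derivative is the integrand by absorption of binomial coefficients, and it
        vanishes at y = r because every exponent of r - y is positive.\<close>
      define G where "G = (\<lambda>y. - g (Suc c) (Suc m) (r - y))"
      have "(G has_real_derivative g c m (r - y)) (at y)" for y
      proof -
        have coef: "real (Suc m choose Suc i) * real (Suc i) / fact (Suc m) = real (m choose i) / fact m" for i
        proof -
          have "real (Suc i) * real (Suc m choose Suc i) = real (Suc m) * real (m choose i)"
            using Suc_times_binomial[of i m] by (metis of_nat_mult)
          then have "real (Suc m choose Suc i) * real (Suc i) / fact (Suc m) =
            (real (Suc m) * real (m choose i)) / (real (Suc m) * fact m)"
            by (simp only: mult.commute fact_Suc)
          then show ?thesis by simp
        qed
        have Geq: "G = (\<lambda>y. \<Sum>i=c..m. - (real (Suc m choose Suc i) / fact (Suc m) * (r - y) ^ Suc i * s ^ (m - i)))"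
          unfolding G_def g_def sum.shift_bounds_cl_Suc_ivl sum_negf sum_divide_distrib by simp
        have "(G has_real_derivative (\<Sum>i=c..m. real (Suc m choose Suc i) / fact (Suc m) *
            (real (Suc i) * (r - y) ^ i) * s ^ (m - i))) (at y)"
          unfolding Geq
        proof (rule DERIV_sum)
          have "((\<lambda>y. - (a * (r - y) ^ Suc i * e)) has_real_derivative a * (real (Suc i) * (r - y) ^ i) * e) (at y)"
            for a e i
            by (rule derivative_eq_intros refl | simp add: mult_ac)+
          then show "((\<lambda>y. - (real (Suc m choose Suc i) / fact (Suc m) * (r - y) ^ Suc i * s ^ (m - i)))
              has_real_derivative real (Suc m choose Suc i) / fact (Suc m) *
                (real (Suc i) * (r - y) ^ i) * s ^ (m - i)) (at y)" for i .
        qed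
        also have "(\<Sum>i=c..m. real (Suc m choose Suc i) / fact (Suc m) *
            (real (Suc i) * (r - y) ^ i) * s ^ (m - i)) =
          (\<Sum>i=c..m. (real (Suc m choose Suc i) * real (Suc i) / fact (Suc m)) * ((r - y) ^ i * s ^ (m - i)))"
          by (simp add: mult_ac)
        also have "\<dots> = g c m (r - y)"
          unfolding coef g_def sum_divide_distrib by (simp add: mult_ac)
        finally show ?thesis .
      qed
      moreover have "(\<lambda>y. g c m (r - y)) \<in> borel_measurable borel"
        unfolding g_def by measurable
      ultimately have "(\<integral>\<^sup>+ y. ennreal (g c m (r - y)) * indicator {0..r} y \<partial>lborel) = ennreal (G r - G 0)"
        using r by (intro nn_integral_FTC_Icc g0) (auto intro: has_field_derivative_at_within)
      also have "G r = 0"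
        by (auto simp: G_def g_def intro!: sum.neutral)
      finally show ?thesis by (simp add: G_def)
    qed
    finally show ?case unfolding cm by (simp add: Un_insert_left)
  qed
  have un: "C \<union> (I - C) = I" using assms by auto
  have "finite C" using assms finite_subset by blast
  then show ?thesis
    using main[of C "I - C" r] assms unfolding un X_def g_def space_PiM space_lborel
    by auto
qed

lemma measure_truncated_simplex:
  fixes R :: "real \<Rightarrow> real \<Rightarrow> bool"
  assumes "R = (<) \<or> R = (\<le>)" "finite I" "C \<subseteq> I" "r > 0" "s \<ge> 0"
  shows "measure (lborel_on I)
      {t \<in> I \<rightarrow>\<^sub>E UNIV. (\<forall>i\<in>I. 0 \<le> t i) \<and> R (sum t C) r \<and> sum t I \<le> r + s} =
    (\<Sum>i=card C..card I. real (card I choose i) * r ^ i * s ^ (card I - i)) / fact (card I)"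
  unfolding measure_def emeasure_truncated_simplex[OF assms]
  using assms by (intro enn2real_ennreal divide_nonneg_nonneg sum_nonneg) auto

section \<open>Coordinates on the hyperplane of sum 2 and the volume cut off by each class\<close>

text \<open>Coordinates are numbered from 1 to \<open>d + 1\<close>, parameters from 0 to \<open>d - 1\<close>; the last coordinate is fixed by the sum 2.\<close>

definition hyperplane_point :: "nat \<Rightarrow> (nat \<Rightarrow> real) \<Rightarrow> nat \<Rightarrow> real" where
  "hyperplane_point d t j = (if j = Suc d then 2 - sum t {..<d} else t (j - 1))"

lemma Diff_last_eq_image_Suc:
  assumes "C \<subseteq> {1..Suc d}"
  shows "C - {Suc d} = Suc ` {i\<in>{..<d}. Suc i \<in> C}"
proof (intro set_eqI iffI)
  fix j assume j: "j \<in> C - {Suc d}"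
  then obtain i where "j = Suc i" using assms by (cases j) auto
  with j assms show "j \<in> Suc ` {i\<in>{..<d}. Suc i \<in> C}" by (auto simp: image_iff)
qed auto

lemma sum_hyperplane_point:
  assumes "C \<subseteq> {1..Suc d}"
  shows "sum (hyperplane_point d t) C =
    sum t {i\<in>{..<d}. Suc i \<in> C} + (if Suc d \<in> C then 2 - sum t {..<d} else 0)"
proof -
  have fin: "finite C" using assms finite_subset by blast
  have "sum (hyperplane_point d t) (C - {Suc d}) = sum t {i\<in>{..<d}. Suc i \<in> C}"
    unfolding Diff_last_eq_image_Suc[OF assms]
    by (subst sum.reindex) (auto simp: hyperplane_point_def intro!: sum.cong)
  moreover have "hyperplane_point d t (Suc d) = 2 - sum t {..<d}"
    by (simp add: hyperplane_point_def)
  ultimately show ?thesis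
    using fin by (cases "Suc d \<in> C") (simp_all add: sum.remove[of C "Suc d"])
qed

lemma sum_hyperplane_point_total: "sum (hyperplane_point d t) {1..Suc d} = 2"
proof -
  have "{i\<in>{..<d}. Suc i \<in> {1..Suc d}} = {..<d}" by auto
  then show ?thesis by (subst sum_hyperplane_point) simp_all
qed

lemma card_Suc_vimage:
  assumes "C \<subseteq> {1..Suc d}"
  shows "card C = card {i\<in>{..<d}. Suc i \<in> C} + (if Suc d \<in> C then 1 else 0)"
proof -
  have fin: "finite C" using assms finite_subset by blast
  have "card (C - {Suc d}) = card {i\<in>{..<d}. Suc i \<in> C}"
    unfolding Diff_last_eq_image_Suc[OF assms] by (simp add: card_image)
  then show ?thesis
    using fin card_Suc_Diff1[of C "Suc d"] by (auto simp: Diff_insert0)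
qed

lemma sum_binomial_upper:
  assumes "c \<le> d"
  shows "(\<Sum>i=d-c..d. real (d choose i)) = (\<Sum>i<Suc c. real (d choose i))"
  using assms
  by (intro sum.reindex_bij_witness[of _ "\<lambda>i. d - i" "\<lambda>i. d - i"]) (auto simp: binomial_symmetric[symmetric])

lemma sum_binomial_split:
  assumes "c \<le> d"
  shows "(\<Sum>i<c. real (d choose i)) + (\<Sum>i=c..d. real (d choose i)) = 2 ^ d"
proof -
  have "(\<Sum>i<c. real (d choose i)) + (\<Sum>i=c..d. real (d choose i)) = (\<Sum>i\<in>{..<c} \<union> {c..d}. real (d choose i))"
    by (rule sum.union_disjoint[symmetric]) auto
  also have "{..<c} \<union> {c..d} = {..d}" using assms by auto
  also have "(\<Sum>i\<le>d. real (d choose i)) = real (\<Sum>i\<le>d. d choose i)" by simp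
  also have "\<dots> = 2 ^ d" by (simp only: choose_row_sum) simp
  finally show ?thesis .
qed

text \<open>In these coordinates the dilated simplex is \<open>S\<close>, and \<open>V C\<close> is
  the piece lost to the class \<open>C\<close>. Each \<open>V C\<close> is a truncated simplex with
  r = s = 1 or the complement of one in \<open>S\<close>, so only binomial coefficients
  remain.\<close>

lemma measure_partition_polytope:
  assumes part: "partition_on {1..Suc d} \<C>"
  shows "measure (lborel_on {..<d}) {t \<in> {..<d} \<rightarrow>\<^sub>E UNIV.
      (\<forall>j\<in>{1..Suc d}. 0 \<le> hyperplane_point d t j) \<and> (\<forall>C\<in>\<C>. sum (hyperplane_point d t) C \<le> 1)} =
    (2 ^ d - (\<Sum>C\<in>\<C>. \<Sum>i<card C. real (d choose i))) / fact d"
proof -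
  let ?L = "lborel_on {..<d}" and ?x = "hyperplane_point d"
  let ?I = "{..<d}"
  have sub: "C \<subseteq> {1..Suc d}" if "C \<in> \<C>" for C
    using part that by (auto simp: partition_on_def)
  have finC: "finite \<C>"
    using finite_elements[OF _ part] by simp
  define T where "T = (\<lambda>R A. {t \<in> ?I \<rightarrow>\<^sub>E UNIV. (\<forall>i\<in>?I. 0 \<le> t i) \<and> R (sum t A) (1::real) \<and> sum t ?I \<le> (1::real) + 1})"
  define S where "S = {t \<in> ?I \<rightarrow>\<^sub>E UNIV. (\<forall>i\<in>?I. 0 \<le> t i) \<and> sum t ?I \<le> (2::real)}"
  have T_meas: "measure ?L (T R A) = (\<Sum>i=card A..d. real (d choose i)) / fact d"
    and T_fin: "emeasure ?L (T R A) \<noteq> \<infinity>" if "R = (<) \<or> R = (\<le>)" "A \<subseteq> ?I" for R A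
    unfolding T_def
    using measure_truncated_simplex[of R ?I A 1 1] emeasure_truncated_simplex[of R ?I A 1 1] that
    by simp_all
  have S_sp: "S = {t \<in> space ?L. (\<forall>i\<in>?I. 0 \<le> t i) \<and> sum t ?I \<le> (2::real)}"
    by (simp add: S_def space_PiM)
  have S_sets: "S \<in> sets ?L"
    unfolding S_sp by measurable
  have T_sp: "T R A = {t \<in> space ?L. (\<forall>i\<in>?I. 0 \<le> t i) \<and> R (sum t A) (1::real) \<and> sum t ?I \<le> (1::real) + 1}" for R A
    by (simp add: T_def space_PiM)
  have T_sets: "T (<) A \<in> sets ?L" "T (\<le>) A \<in> sets ?L" if "A \<subseteq> ?I" for A
  proof -
    have [measurable]: "(\<lambda>t. sum t A) \<in> borel_measurable ?L"
      using that by (intro borel_measurable_sum measurable_component_singleton) auto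
    show "T (<) A \<in> sets ?L" "T (\<le>) A \<in> sets ?L" unfolding T_sp by measurable
  qed
  have ST: "S = T (\<le>) {}" by (simp add: S_def T_def)
  have S_fin: "emeasure ?L S \<noteq> \<infinity>" unfolding ST by (rule T_fin) auto
  have S_meas: "measure ?L S = 2 ^ d / fact d"
    unfolding ST using T_meas[of "(\<le>)" "{}"] sum_binomial_split[of 0 d] by simp
  define V where "V = (\<lambda>C. {t \<in> S. 1 < sum (?x t) C})"
  have V: "V C \<in> sets ?L \<and> measure ?L (V C) = (\<Sum>i<card C. real (d choose i)) / fact d" if "C \<in> \<C>" for C
  proof -
    define A where "A = {i\<in>?I. Suc i \<in> C}"
    have A: "A \<subseteq> ?I" "finite A" by (auto simp: A_def)
    have cA: "card A \<le> d" using card_mono[OF _ A(1)] by simp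
    note s = sum_hyperplane_point[OF sub[OF that], folded A_def]
    note c = card_Suc_vimage[OF sub[OF that], folded A_def]
    show ?thesis
    proof (cases "Suc d \<in> C")
      \<comment> \<open>The weight of \<open>C\<close> is now 2 minus the sum over the parameters
        outside \<open>A\<close>, so the piece bounds that sum strictly by 1. Its volume is an upper
        binomial tail starting at d - card A; reflected, the tail has card A + 1 = card C
        terms.\<close>
      case True
      have "sum t A = sum t ?I - sum t (?I - A)" for t :: "nat \<Rightarrow> real"
        using sum.subset_diff[OF A(1), of t] by simp
      then have "V C = T (<) (?I - A)"
        using True by (auto simp: V_def S_def T_def s)
      moreover have "card (?I - A) = d - card A"
        using A by (simp add: card_Diff_subset)
      ultimately show ?thesis
        using T_sets[of "?I - A"] T_meas[of "(<)" "?I - A"] c True sum_binomial_upper[OF cA] by auto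
    next
      \<comment> \<open>Here the weight of \<open>C\<close> is the sum over \<open>A\<close> itself,
        so the piece is what the weak bound leaves over: the row sum 2^d minus the upper tail from
        \<open>card A\<close> on, with card A = card C.\<close>
      case False
      have eq: "V C = S - T (\<le>) A"
        using False by (auto simp: V_def S_def T_def s)
      have "measure ?L (S - T (\<le>) A) = measure ?L S - measure ?L (T (\<le>) A)"
        using S_fin S_sets T_sets[OF A(1)] by (intro measure_Diff) (auto simp: S_def T_def)
      also have "\<dots> = (\<Sum>i<card A. real (d choose i)) / fact d"
        using T_meas[of "(\<le>)" A] A S_meas sum_binomial_split[OF cA] by (simp add: field_simps)
      finally show ?thesis
        using eq S_sets T_sets[OF A(1)] c False by auto
    qed
  qed
  have VS: "V C \<subseteq> S" for C by (auto simp: V_def)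
  have nonneg: "(\<forall>j\<in>{1..Suc d}. 0 \<le> ?x t j) \<longleftrightarrow> (\<forall>i\<in>?I. 0 \<le> t i) \<and> sum t ?I \<le> 2" for t
  proof -
    have "{1..Suc d} = insert (Suc d) (Suc ` ?I)"
      unfolding image_Suc_lessThan by auto
    then show ?thesis by (auto simp: hyperplane_point_def)
  qed
  have disj: "disjoint_family_on V \<C>"
    unfolding disjoint_family_on_def
  proof (intro ballI impI, rule ccontr)
    fix C D assume CD: "C \<in> \<C>" "D \<in> \<C>" "C \<noteq> D" and "V C \<inter> V D \<noteq> {}"
    then obtain t where t: "t \<in> S" "1 < sum (?x t) C" "1 < sum (?x t) D" by (auto simp: V_def)
    have "C \<inter> D = {}" using part CD by (auto simp: partition_on_def disjoint_def)
    then have "sum (?x t) C + sum (?x t) D = sum (?x t) (C \<union> D)"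
      using sub CD by (metis sum.union_disjoint finite_subset finite_atLeastAtMost)
    also have "\<dots> \<le> sum (?x t) {1..Suc d}"
      using sub CD t(1) nonneg[of t] by (intro sum_mono2) (auto simp: S_def)
    also have "\<dots> = 2" by (rule sum_hyperplane_point_total)
    finally show False using t by simp
  qed
  have "{t \<in> ?I \<rightarrow>\<^sub>E UNIV. (\<forall>j\<in>{1..Suc d}. 0 \<le> ?x t j) \<and> (\<forall>C\<in>\<C>. sum (?x t) C \<le> 1)}
      = S - (\<Union>C\<in>\<C>. V C)"
    unfolding nonneg S_def V_def by (auto simp: not_less)
  moreover have "measure ?L (S - (\<Union>C\<in>\<C>. V C)) = measure ?L S - measure ?L (\<Union>C\<in>\<C>. V C)"
    using V VS S_fin S_sets finC by (intro measure_Diff) auto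
  moreover have "measure ?L (\<Union>C\<in>\<C>. V C) = (\<Sum>C\<in>\<C>. measure ?L (V C))"
  proof (rule measure_finite_Union[OF finC _ disj])
    show "V ` \<C> \<subseteq> sets ?L" using V by auto
    show "emeasure ?L (V C) \<noteq> \<infinity>" if "C \<in> \<C>" for C
      using emeasure_mono[OF VS S_sets, of C] S_fin by (auto simp: top_unique)
  qed
  ultimately show ?thesis
    using V S_meas by (simp add: sum_divide_distrib[symmetric] diff_divide_distrib)
qed

section \<open>Polytopes of rank-two matroids\<close>

lemma lookup_scaleR [simp]:
  "Poly_Mapping.lookup (r *\<^sub>R x) i = r *\<^sub>R Poly_Mapping.lookup x i"
proof -
  have "finite {i. r *\<^sub>R Poly_Mapping.lookup x i \<noteq> 0}"
    by (rule finite_subset[OF _ finite_lookup[of x]]) auto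
  then show ?thesis
    by (simp add: scaleR_poly_mapping_def Abs_poly_mapping_inverse)
qed

lemma lookup_indicator_vector:
  "finite B \<Longrightarrow> Poly_Mapping.lookup (indicator_vector B) i = (if i \<in> B then 1 else 0)"
  by (simp add: indicator_vector_def lookup_sum lookup_single when_def)

text \<open>These are the bases of the loopless rank-two matroid whose parallel classes are the
  members of \<open>\<C>\<close>.\<close>

definition transversal_pairs :: "'a set set \<Rightarrow> 'a set set" where
  "transversal_pairs \<C> = {{a, b} |a b. \<exists>C\<in>\<C>. \<exists>D\<in>\<C>. C \<noteq> D \<and> a \<in> C \<and> b \<in> D}"

lemma transversal_pairsI:
  "C \<in> \<C> \<Longrightarrow> D \<in> \<C> \<Longrightarrow> C \<noteq> D \<Longrightarrow> a \<in> C \<Longrightarrow> b \<in> D \<Longrightarrow> {a, b} \<in> transversal_pairs \<C>"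
  unfolding transversal_pairs_def by blast

lemma sum_indicator_vector_pair:
  assumes "finite A" "a \<noteq> b"
  shows "sum (Poly_Mapping.lookup (indicator_vector {a, b})) A =
    (if a \<in> A then 1 else 0) + (if b \<in> A then 1 else 0)"
proof -
  have "sum (Poly_Mapping.lookup (indicator_vector {a, b})) A =
    (\<Sum>i\<in>A. (if i = a then 1 else 0) + (if i = b then 1 else 0))"
    using assms(2) by (intro sum.cong) (auto simp: lookup_indicator_vector)
  then show ?thesis using assms(1) by (simp add: sum.distrib)
qed

lemma partition_on_class_unique:
  "partition_on E \<C> \<Longrightarrow> C \<in> \<C> \<Longrightarrow> D \<in> \<C> \<Longrightarrow> a \<in> C \<Longrightarrow> a \<in> D \<Longrightarrow> C = D"
  by (auto simp: partition_on_def disjoint_def)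

context
  fixes E :: "nat set" and \<C> :: "nat set set"
  assumes finE: "finite E" and part: "partition_on E \<C>"
begin

lemma partition_classes:
  shows "finite \<C>" and "C \<in> \<C> \<Longrightarrow> C \<subseteq> E" and "C \<in> \<C> \<Longrightarrow> finite C" and "C \<in> \<C> \<Longrightarrow> C \<noteq> {}"
proof -
  show "finite \<C>" using finite_elements[OF finE part] .
  show sub: "C \<in> \<C> \<Longrightarrow> C \<subseteq> E" using part by (auto simp: partition_on_def)
  show "C \<in> \<C> \<Longrightarrow> finite C" using sub finE finite_subset by blast
  show "C \<in> \<C> \<Longrightarrow> C \<noteq> {}" using part by (auto simp: partition_on_def)
qed

lemma sum_classes:
  "(\<Sum>C\<in>\<C>. sum f C) = sum (f :: nat \<Rightarrow> real) E"
proof -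
  have "sum f (\<Union>\<C>) = (\<Sum>C\<in>\<C>. sum f C)"
    using part partition_classes by (subst sum.Union_disjoint) (auto simp: partition_on_def disjoint_def)
  then show ?thesis using part by (simp add: partition_on_def)
qed

text \<open>
  Removing a pair from two classes of maximal weight keeps every class below half of the total
  weight; removing as much as possible either deletes a coordinate from the support or makes a
  further class weigh exactly half of the total.
\<close>

lemma scaled_point_in_pair_hull:
  fixes x :: "nat \<Rightarrow>\<^sub>0 real" and s :: real
  assumes "s > 0"
    and "\<And>i. 0 \<le> Poly_Mapping.lookup x i"
    and "\<And>i. i \<notin> E \<Longrightarrow> Poly_Mapping.lookup x i = 0"
    and "sum (Poly_Mapping.lookup x) E = 2 * s"
    and "\<And>C. C \<in> \<C> \<Longrightarrow> sum (Poly_Mapping.lookup x) C \<le> s"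
  shows "(1 / s) *\<^sub>R x \<in> convex hull (indicator_vector ` transversal_pairs \<C>)"
  using assms
\<comment> \<open>The measure adds the size of the support and the number of classes not yet at the
  bound s. The scale s must vary, because subtracting \<epsilon> times a vertex lowers the total
  from 2s to 2(s - \<epsilon>).\<close>
proof (induction "card {i \<in> E. Poly_Mapping.lookup x i \<noteq> 0} +
    card {C \<in> \<C>. sum (Poly_Mapping.lookup x) C \<noteq> s}" arbitrary: x s rule: less_induct)
  case (less x s)
  let ?K = "convex hull (indicator_vector ` transversal_pairs \<C>)"
  let ?f = "Poly_Mapping.lookup x"
  define y where "y = (\<lambda>C. sum ?f C)"
  note s = less.prems(1) and nn = less.prems(2) and supp = less.prems(3) and tot = less.prems(4)
  have yle: "y C \<le> s" if "C \<in> \<C>" for C using less.prems(5)[OF that] by (simp add: y_def)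
  have ynn: "0 \<le> y C" for C unfolding y_def using nn by (rule sum_nonneg)
  have ysum: "sum y \<C> = 2 * s"
    unfolding y_def sum_classes using tot by simp
  have ex_max: "\<exists>C\<in>A. \<forall>F\<in>A. y F \<le> y C" if "finite A" "A \<noteq> {}" for A
    using Max_in[of "y ` A"] Max_ge[of "y ` A"] that by fastforce
  have "\<C> \<noteq> {}" using ysum s by auto
  then obtain C where C: "C \<in> \<C>" "\<And>F. F \<in> \<C> \<Longrightarrow> y F \<le> y C"
    using ex_max[OF partition_classes(1)] by blast
  have rest: "sum y (\<C> - {C}) = 2 * s - y C"
    using sum.remove[OF partition_classes(1) C(1), of y] ysum by simp
  have "\<C> - {C} \<noteq> {}"
  proof
    assume "\<C> - {C} = {}"
    then have "2 * s - y C = 0" using rest by (metis sum.empty)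
    then show False using yle[OF C(1)] s by simp
  qed
  then obtain D where D: "D \<in> \<C> - {C}" "\<And>F. F \<in> \<C> - {C} \<Longrightarrow> y F \<le> y D"
    using ex_max[of "\<C> - {C}"] partition_classes(1) by blast
  have CD: "C \<noteq> D" "D \<in> \<C>" using D by auto
  have yD: "y D > 0"
  proof (rule ccontr)
    assume "\<not> y D > 0"
    then have "sum y (\<C> - {C}) \<le> 0" using D(2) by (intro sum_nonpos) (meson not_less order_trans)
    then show False using rest yle[OF C(1)] s by simp
  qed
  have yC: "y C > 0" using C(2)[OF CD(2)] yD by simp
  \<comment> \<open>If a third class had weight s, maximality would give \<open>C\<close> and
    \<open>D\<close> weight s too, a total of at least 3s > 2s.\<close>
  have tight: "F = C \<or> F = D" if F: "F \<in> \<C>" "y F = s" for F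
  proof (rule ccontr)
    assume n: "\<not> (F = C \<or> F = D)"
    then have "y D = s" "y C = s"
      using F C(2)[OF F(1)] D(2)[of F] yle C(1) CD(2) by (auto intro: antisym)
    moreover have "sum y {C, D, F} \<le> sum y \<C>"
      using C(1) CD(2) F(1) ynn partition_classes(1) by (intro sum_mono2) auto
    moreover have "C \<noteq> F" "D \<noteq> F" using n by auto
    ultimately show False using CD F(2) ysum s by simp
  qed
  have ex_pos: "\<exists>a\<in>F. ?f a > 0" if "y F > 0" for F
  proof (rule ccontr)
    assume "\<not> (\<exists>a\<in>F. ?f a > 0)"
    then have "y F \<le> 0" unfolding y_def by (intro sum_nonpos) (auto simp: not_less)
    then show False using that by simp
  qed
  obtain a where a: "a \<in> C" "?f a > 0" using ex_pos[OF yC] by blast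
  obtain b where b: "b \<in> D" "?f b > 0" using ex_pos[OF yD] by blast
  have ab: "a \<noteq> b" using partition_on_class_unique[OF part C(1) CD(2)] CD(1) a b by blast
  let ?e = "indicator_vector {a, b}"
  have eK: "?e \<in> ?K"
    by (intro hull_inc imageI transversal_pairsI[OF C(1) CD(2) CD(1) a(1) b(1)])
  \<comment> \<open>The obstructions to a longer step: the coordinates at a and b must stay
    nonnegative, and a class other than \<open>C\<close> and \<open>D\<close> keeps its weight while
    its bound drops to s - \<epsilon>.\<close>
  define M where "M = insert (?f a) (insert (?f b) ((\<lambda>F. s - y F) ` (\<C> - {C, D})))"
  define \<epsilon> where "\<epsilon> = Min M"
  have finM: "finite M" "M \<noteq> {}" using partition_classes(1) by (auto simp: M_def)
  have eM: "\<epsilon> \<in> M" unfolding \<epsilon>_def by (rule Min_in[OF finM])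
  have ele: "\<epsilon> \<le> m" if "m \<in> M" for m unfolding \<epsilon>_def by (rule Min_le[OF finM(1) that])
  have "m > 0" if "m \<in> M" for m
  proof -
    have "s - y F > 0" if "F \<in> \<C> - {C, D}" for F
      using tight[of F] yle[of F] that by fastforce
    then have "\<forall>z\<in>(\<lambda>F. s - y F) ` (\<C> - {C, D}). z > 0" by blast
    then show ?thesis using that a(2) b(2) unfolding M_def by (elim insertE) blast+
  qed
  then have e0: "\<epsilon> > 0" using eM by blast
  have ea: "\<epsilon> \<le> ?f a" "\<epsilon> \<le> ?f b" by (auto intro!: ele simp: M_def)
  have eF: "y F \<le> s - \<epsilon>" if "F \<in> \<C>" "F \<noteq> C" "F \<noteq> D" for F
  proof -
    have "s - y F \<in> M" using that by (auto simp: M_def)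
    then show ?thesis using ele by fastforce
  qed
  define x' where "x' = x - \<epsilon> *\<^sub>R ?e"
  have f': "Poly_Mapping.lookup x' i = ?f i - (if i = a \<or> i = b then \<epsilon> else 0)" for i
    by (auto simp: x'_def lookup_minus lookup_indicator_vector)
  have sum': "sum (Poly_Mapping.lookup x') A = sum ?f A - \<epsilon> * ((if a \<in> A then 1 else 0) + (if b \<in> A then 1 else 0))"
    if "finite A" for A
    unfolding sum_indicator_vector_pair[OF that ab, symmetric]
    by (simp add: x'_def lookup_minus sum_subtractf sum_distrib_left)
  have aE: "a \<in> E" "b \<in> E" using a b partition_classes(2) C(1) CD(2) by auto
  have aF: "a \<in> F \<longleftrightarrow> F = C" and bF: "b \<in> F \<longleftrightarrow> F = D" if "F \<in> \<C>" for F
    using partition_on_class_unique[OF part that C(1)] partition_on_class_unique[OF part that CD(2)] a b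
    by blast+
  have y': "sum (Poly_Mapping.lookup x') F = y F - (if F = C \<or> F = D then \<epsilon> else 0)" if "F \<in> \<C>" for F
    using sum'[OF partition_classes(3)[OF that]] aF[OF that] bF[OF that] CD(1) by (auto simp: y_def)
  have nn': "0 \<le> Poly_Mapping.lookup x' i" for i
    using ea nn[of i] by (auto simp: f')
  have supp': "Poly_Mapping.lookup x' i = 0" if "i \<notin> E" for i
    using that aE supp[OF that] by (auto simp: f')
  have tot': "sum (Poly_Mapping.lookup x') E = 2 * (s - \<epsilon>)"
    using sum'[OF finE] aE tot by simp
  have y'le: "sum (Poly_Mapping.lookup x') F \<le> s - \<epsilon>" if "F \<in> \<C>" for F
    using y'[OF that] yle[OF that] eF[OF that] by auto
  have "s - \<epsilon> \<ge> 0"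
  proof -
    have "?f a \<le> y C"
      unfolding y_def using a(1) nn partition_classes(3)[OF C(1)] by (intro member_le_sum) auto
    then show ?thesis using ea yle[OF C(1)] by linarith
  qed
  then consider "s = \<epsilon>" | "s - \<epsilon> > 0" by fastforce
  then show ?case
  proof cases
    case 1
    have "Poly_Mapping.lookup x' i = 0" for i
    proof (cases "i \<in> E")
      case True
      then show ?thesis using tot' 1 sum_nonneg_eq_0_iff[OF finE, of "Poly_Mapping.lookup x'"] nn' by simp
    qed (rule supp')
    then have "x' = 0" by (intro poly_mapping_eqI) simp
    then have "x = s *\<^sub>R ?e" using 1 by (simp add: x'_def)
    then show ?thesis using eK s by simp
  next
    case 2
    let ?S = "{i \<in> E. ?f i \<noteq> 0}" and ?S' = "{i \<in> E. Poly_Mapping.lookup x' i \<noteq> 0}"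
    let ?N = "{C \<in> \<C>. sum ?f C \<noteq> s}" and ?N' = "{C \<in> \<C>. sum (Poly_Mapping.lookup x') C \<noteq> s - \<epsilon>}"
    have SS: "?S' \<subseteq> ?S" using a b by (auto simp: f')
    \<comment> \<open>A class at the bound is \<open>C\<close> or \<open>D\<close>; it loses
      \<epsilon> together with the bound and so stays at the bound.\<close>
    have NN: "?N' \<subseteq> ?N" using y' tight by (auto simp: y_def)
    have "?S' \<noteq> ?S \<or> ?N' \<noteq> ?N"
    proof -
      consider "\<epsilon> = ?f a" | "\<epsilon> = ?f b" | F where "F \<in> \<C>" "F \<noteq> C" "F \<noteq> D" "\<epsilon> = s - y F"
        using eM by (auto simp: M_def)
      then show ?thesis
      proof cases
        case 1
        then have "a \<in> ?S" "a \<notin> ?S'" using a aE by (auto simp: f')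
        then show ?thesis by blast
      next
        case 2
        then have "b \<in> ?S" "b \<notin> ?S'" using b aE by (auto simp: f')
        then show ?thesis by blast
      next
        case (3 F)
        then have "F \<in> ?N" "F \<notin> ?N'" using y'[OF 3(1)] e0 by (auto simp: y_def)
        then show ?thesis by blast
      qed
    qed
    then have "?S' \<subset> ?S \<or> ?N' \<subset> ?N" using SS NN by blast
    moreover have "card ?S' \<le> card ?S" "card ?N' \<le> card ?N"
      using SS NN finE partition_classes(1) by (auto intro!: card_mono)
    moreover have "?S' \<subset> ?S \<Longrightarrow> card ?S' < card ?S" "?N' \<subset> ?N \<Longrightarrow> card ?N' < card ?N"
      using finE partition_classes(1) by (auto intro!: psubset_card_mono)
    ultimately have "card ?S' + card ?N' < card ?S + card ?N" by linarith
    from less.hyps[OF this 2 nn' supp' tot' y'le]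
    have IH: "(1 / (s - \<epsilon>)) *\<^sub>R x' \<in> ?K" .
    have "((s - \<epsilon>) / s) *\<^sub>R ((1 / (s - \<epsilon>)) *\<^sub>R x') + (\<epsilon> / s) *\<^sub>R ?e \<in> ?K"
      using 2 e0 s by (intro convexD[OF convex_convex_hull IH eK]) (auto simp: field_simps)
    also have "((s - \<epsilon>) / s) *\<^sub>R ((1 / (s - \<epsilon>)) *\<^sub>R x') + (\<epsilon> / s) *\<^sub>R ?e = (1 / s) *\<^sub>R x"
      using 2 by (simp add: x'_def scaleR_diff_right)
    finally show ?thesis .
  qed
qed

text \<open>The bounds on the classes are the rank inequalities of the rank-one flats. That they
  suffice is the decomposition above with s = 1.\<close>

lemma convex_hull_transversal_pairs:
  "convex hull (indicator_vector ` transversal_pairs \<C>) =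
    {x. (\<forall>i. 0 \<le> Poly_Mapping.lookup x i) \<and> (\<forall>i. i \<notin> E \<longrightarrow> Poly_Mapping.lookup x i = 0) \<and>
        sum (Poly_Mapping.lookup x) E = 2 \<and> (\<forall>C\<in>\<C>. sum (Poly_Mapping.lookup x) C \<le> 1)}"
  (is "_ = ?P")
proof
  show "convex hull (indicator_vector ` transversal_pairs \<C>) \<subseteq> ?P"
  proof (rule hull_minimal)
    show "indicator_vector ` transversal_pairs \<C> \<subseteq> ?P"
    proof
      fix x assume "x \<in> indicator_vector ` transversal_pairs \<C>"
      then obtain a b C D where CD: "C \<in> \<C>" "D \<in> \<C>" "C \<noteq> D" "a \<in> C" "b \<in> D"
        and x: "x = indicator_vector {a, b}"
        by (auto simp: transversal_pairs_def)
      have ab: "a \<noteq> b" "a \<in> E" "b \<in> E"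
        using CD partition_classes(2) partition_on_class_unique[OF part CD(1,2)] by auto
      have "sum (Poly_Mapping.lookup x) E = 2"
        using ab finE by (simp add: x sum_indicator_vector_pair)
      moreover have "sum (Poly_Mapping.lookup x) F \<le> 1" if F: "F \<in> \<C>" for F
      proof -
        have "\<not> (a \<in> F \<and> b \<in> F)"
          using CD partition_on_class_unique[OF part F] by metis
        then show ?thesis
          using partition_classes(3)[OF F] ab(1) by (auto simp: x sum_indicator_vector_pair)
      qed
      ultimately show "x \<in> ?P"
        using ab by (auto simp: x lookup_indicator_vector)
    qed
    show "convex ?P"
    proof (rule convexI)
      fix x y and u v :: real
      assume x: "x \<in> ?P" and y: "y \<in> ?P" and uv: "0 \<le> u" "0 \<le> v" "u + v = 1"
      let ?z = "u *\<^sub>R x + v *\<^sub>R y"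
      have z: "sum (Poly_Mapping.lookup ?z) A = u * sum (Poly_Mapping.lookup x) A + v * sum (Poly_Mapping.lookup y) A" for A
        by (simp add: lookup_add sum.distrib sum_distrib_left)
      have "sum (Poly_Mapping.lookup ?z) E = 2"
        using x y uv(3) unfolding z by (simp flip: distrib_right)
      moreover have "sum (Poly_Mapping.lookup ?z) C \<le> 1" if "C \<in> \<C>" for C
        unfolding z using x y uv that by (intro convex_bound_le) auto
      ultimately show "?z \<in> ?P" using x y uv by (auto simp: lookup_add)
    qed
  qed
  show "?P \<subseteq> convex hull (indicator_vector ` transversal_pairs \<C>)"
  proof
    fix x assume "x \<in> ?P"
    then show "x \<in> convex hull (indicator_vector ` transversal_pairs \<C>)"
      using scaled_point_in_pair_hull[of 1 x] by simp
  qed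
qed

text \<open>For any i and j, a third class supplies an element c outside the classes of both, and
  the vertices of {i, c} and {j, c} differ by the difference of the unit vectors i and j. These
  differences span the directions of the hyperplane. With only two classes, each would have weight
  exactly 1 on the whole hull, and the dimension would drop.\<close>

lemma affine_hull_transversal_pairs:
  assumes three: "3 \<le> card \<C>"
  shows "affine hull (indicator_vector ` transversal_pairs \<C>) =
    {x. (\<forall>i. i \<notin> E \<longrightarrow> Poly_Mapping.lookup x i = 0) \<and> sum (Poly_Mapping.lookup x) E = 2}"
  (is "?H = ?A")
proof
  show "?H \<subseteq> ?A"
  proof (rule hull_minimal)
    show "indicator_vector ` transversal_pairs \<C> \<subseteq> ?A"
      using convex_hull_transversal_pairs hull_subset[of "indicator_vector ` transversal_pairs \<C>" convex] by auto
    show "affine ?A"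
      unfolding affine_def
    proof (intro ballI allI impI)
      fix x y and u v :: real
      assume x: "x \<in> ?A" and y: "y \<in> ?A" and uv: "u + v = 1"
      have "sum (Poly_Mapping.lookup (u *\<^sub>R x + v *\<^sub>R y)) E = (u + v) * 2"
        using x y by (simp add: lookup_add sum.distrib sum_distrib_left[symmetric] distrib_right)
      then show "u *\<^sub>R x + v *\<^sub>R y \<in> ?A" using x y uv by (simp add: lookup_add)
    qed
  qed
  show "?A \<subseteq> ?H"
  proof
    fix x assume x: "x \<in> ?A"
    have other: "\<exists>c F. F \<in> \<C> \<and> c \<in> F \<and> F \<noteq> C \<and> F \<noteq> D" for C D
    proof -
      have "card {C, D} \<le> 2" by (simp add: card_insert_if)
      then have "\<not> \<C> \<subseteq> {C, D}" using three card_mono[of "{C, D}" \<C>] by fastforce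
      then show ?thesis using partition_classes(4) by blast
    qed
    have swap: "\<exists>u w. u \<in> ?H \<and> w \<in> ?H \<and> u - w = Poly_Mapping.single i 1 - Poly_Mapping.single j 1"
      if "i \<in> E" "j \<in> E" for i j
    proof -
      obtain C D where CD: "C \<in> \<C>" "D \<in> \<C>" "i \<in> C" "j \<in> D"
        using \<open>i \<in> E\<close> \<open>j \<in> E\<close> part by (auto simp: partition_on_def)
      obtain c F where F: "F \<in> \<C>" "c \<in> F" "F \<noteq> C" "F \<noteq> D"
        using other[of C D] by blast
      have ne: "i \<noteq> c" "j \<noteq> c"
        using CD(3,4) F partition_on_class_unique[OF part F(1) CD(1)]
          partition_on_class_unique[OF part F(1) CD(2)] by blast+
      have "indicator_vector {i, c} \<in> ?H"
        by (intro hull_inc imageI transversal_pairsI[OF CD(1) F(1) F(3)[symmetric] CD(3) F(2)])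
      moreover have "indicator_vector {j, c} \<in> ?H"
        by (intro hull_inc imageI transversal_pairsI[OF CD(2) F(1) F(4)[symmetric] CD(4) F(2)])
      moreover have "indicator_vector {i, c} - indicator_vector {j, c} =
          Poly_Mapping.single i 1 - Poly_Mapping.single j 1"
        using ne by (simp add: indicator_vector_def)
      ultimately show ?thesis by blast
    qed
    obtain C where C: "C \<in> \<C>" using three by fastforce
    obtain j where j: "j \<in> C" using partition_classes(4)[OF C] by blast
    obtain c F where F: "F \<in> \<C>" "c \<in> F" "F \<noteq> C" using other[of C C] by blast
    have jE: "j \<in> E" using j C partition_classes(2) by blast
    define q where "q = indicator_vector {j, c}"
    have q: "q \<in> ?H"
      unfolding q_def by (intro hull_inc imageI transversal_pairsI[OF C F(1) F(3)[symmetric] j F(2)])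
    then have qA: "q \<in> ?A" using \<open>?H \<subseteq> ?A\<close> by blast
    let ?w = "\<lambda>i. Poly_Mapping.single i (1::real) - Poly_Mapping.single j 1"
    have move: "q + (\<Sum>i\<in>G. g i *\<^sub>R ?w i) \<in> ?H" if "finite G" "G \<subseteq> E" for G g
      using that
    proof (induction rule: finite_induct)
      case empty
      then show ?case using q by simp
    next
      case (insert i G)
      obtain u w where uw: "u \<in> ?H" "w \<in> ?H" "u - w = ?w i"
        using swap[of i j] insert.prems jE by blast
      have "(q + (\<Sum>i\<in>G. g i *\<^sub>R ?w i)) + g i *\<^sub>R (u - w) \<in> ?H"
        using insert uw by (intro mem_affine_3_minus affine_affine_hull) auto
      then show ?case using insert uw(3) by (simp add: algebra_simps)
    qed
    \<comment> \<open>The coefficients sum to 0, as \<open>x\<close> and \<open>q\<close> have the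
      same total, so the contributions at the reference coordinate j cancel.\<close>
    have "q + (\<Sum>i\<in>E. (Poly_Mapping.lookup x i - Poly_Mapping.lookup q i) *\<^sub>R ?w i) \<in> ?H"
      by (rule move[OF finE order_refl])
    moreover have "q + (\<Sum>i\<in>E. (Poly_Mapping.lookup x i - Poly_Mapping.lookup q i) *\<^sub>R ?w i) = x"
      (is "q + ?S = x")
    proof (rule poly_mapping_eqI)
      fix k
      let ?d = "\<lambda>i. Poly_Mapping.lookup x i - Poly_Mapping.lookup q i"
      have d0: "sum ?d E = 0" using x qA by (simp add: sum_subtractf)
      have "Poly_Mapping.lookup ?S k = (\<Sum>i\<in>E. ?d i * ((if i = k then 1 else 0) - (if j = k then 1 else 0)))"
        by (simp add: lookup_sum lookup_minus lookup_single when_def)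
      also have "\<dots> = (\<Sum>i\<in>E. ?d i * (if i = k then 1 else 0)) - (\<Sum>i\<in>E. ?d i * (if j = k then 1 else 0))"
        by (simp only: right_diff_distrib sum_subtractf)
      also have "(\<Sum>i\<in>E. ?d i * (if j = k then 1 else 0)) = 0"
        unfolding sum_distrib_right[symmetric] d0 by simp
      also have "(\<Sum>i\<in>E. ?d i * (if i = k then 1 else 0)) = (if k \<in> E then ?d k else 0)"
        using finE by (simp add: if_distrib[of "\<lambda>z. _ * z"] cong: if_cong)
      finally show "Poly_Mapping.lookup (q + ?S) k = Poly_Mapping.lookup x k"
        using x qA by (auto simp: lookup_add)
    qed
    ultimately show "x \<in> ?H" by simp
  qed
qed

end

section \<open>The lattice path matroids of rank two\<close>

lemma lookup_hyperplane_point: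
  "Poly_Mapping.lookup (2 *\<^sub>R Poly_Mapping.single (Suc d) 1 +
      (\<Sum>i<d. t i *\<^sub>R (Poly_Mapping.single (Suc i) 1 - Poly_Mapping.single (Suc d) 1))) j =
    (if j \<in> {1..Suc d} then hyperplane_point d t j else 0)"
proof (cases j)
  case (Suc k)
  have "(\<Sum>i<d. t i * ((if i = k then 1 else 0) - (if d = k then 1 else 0))) =
      (\<Sum>i<d. if i = k then t i else 0) - (\<Sum>i<d. if d = k then t i else 0)"
    unfolding sum_subtractf[symmetric] by (intro sum.cong) auto
  also have "\<dots> = (if k < d then t k else 0) - (if d = k then sum t {..<d} else 0)"
    by simp
  finally show ?thesis
    by (auto simp: Suc lookup_add lookup_sum lookup_minus lookup_single when_def hyperplane_point_def)
qed (simp add: lookup_add lookup_sum lookup_minus lookup_single)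

text \<open>The parameters are the first d coordinates themselves, and the last one is 2 minus their
  sum, so a point is integral exactly when its parameters are. The base point is a vertex of the
  dilated simplex, outside the matroid polytope.\<close>

lemma affine_lattice_basis_hyperplane:
  "affine_lattice_basis
    {x. (\<forall>i. i \<notin> {1..Suc d} \<longrightarrow> Poly_Mapping.lookup x i = 0) \<and> sum (Poly_Mapping.lookup x) {1..Suc d} = 2}
    (2 *\<^sub>R Poly_Mapping.single (Suc d) 1) d
    (\<lambda>i. Poly_Mapping.single (Suc i) 1 - Poly_Mapping.single (Suc d) 1)"
  (is "affine_lattice_basis ?A ?p d ?v")
proof -
  define \<phi> where "\<phi> = (\<lambda>t. ?p + (\<Sum>i<d. t i *\<^sub>R ?v i))"
  have look: "Poly_Mapping.lookup (\<phi> t) j = (if j \<in> {1..Suc d} then hyperplane_point d t j else 0)" for t j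
    unfolding \<phi>_def by (rule lookup_hyperplane_point)
  have look_Suc: "Poly_Mapping.lookup (\<phi> t) (Suc i) = t i" if "i < d" for t i
    using that by (simp add: look hyperplane_point_def)
  have lookv: "Poly_Mapping.lookup (?v i) (Suc j) = (if i = j then 1 else 0)" if "i < d" "j < d" for i j
    using that by (simp add: lookup_minus lookup_single when_def)
  have inj: "inj_on ?v {..<d}"
  proof (rule inj_onI)
    fix i j assume ij: "i \<in> {..<d}" "j \<in> {..<d}" "?v i = ?v j"
    then have "Poly_Mapping.lookup (?v i) (Suc j) = Poly_Mapping.lookup (?v j) (Suc j)" by simp
    then show "i = j" using ij(1,2) lookv by (auto split: if_splits)
  qed
  have ind: "independent (?v ` {..<d})"
  proof (rule independent_if_scalars_zero)
    fix f x assume f: "(\<Sum>x\<in>?v ` {..<d}. f x *\<^sub>R x) = 0" and "x \<in> ?v ` {..<d}"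
    then obtain i where i: "i < d" "x = ?v i" by auto
    have "(\<Sum>i<d. f (?v i) *\<^sub>R ?v i) = 0"
      using f unfolding sum.reindex[OF inj] by (simp add: o_def)
    then have "\<phi> (\<lambda>i. f (?v i)) = \<phi> (\<lambda>_. 0)" by (simp add: \<phi>_def)
    then have "Poly_Mapping.lookup (\<phi> (\<lambda>i. f (?v i))) (Suc i) = Poly_Mapping.lookup (\<phi> (\<lambda>_. 0)) (Suc i)" by simp
    then show "f x = 0" using i by (simp add: look_Suc)
  qed simp
  have \<phi>A: "\<phi> t \<in> ?A" for t
  proof -
    have "sum (Poly_Mapping.lookup (\<phi> t)) {1..Suc d} = sum (hyperplane_point d t) {1..Suc d}"
      by (intro sum.cong) (auto simp: look)
    also have "\<dots> = 2" by (rule sum_hyperplane_point_total)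
    finally show ?thesis by (auto simp: look)
  qed
  have A\<phi>: "x = \<phi> (\<lambda>i. Poly_Mapping.lookup x (Suc i))" if x: "x \<in> ?A" for x
  proof (rule poly_mapping_eqI)
    fix j
    have img: "{1..d} = Suc ` {..<d}" by (simp add: image_Suc_lessThan)
    have "(\<Sum>i<d. Poly_Mapping.lookup x (Suc i)) = sum (Poly_Mapping.lookup x) {1..d}"
      unfolding img by (subst sum.reindex) auto
    then have "(\<Sum>i<d. Poly_Mapping.lookup x (Suc i)) + Poly_Mapping.lookup x (Suc d) = 2"
      using x by simp
    then show "Poly_Mapping.lookup x j = Poly_Mapping.lookup (\<phi> (\<lambda>i. Poly_Mapping.lookup x (Suc i))) j"
      using x by (auto simp: look hyperplane_point_def)
  qed
  have A: "?A = range \<phi>"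
    using \<phi>A A\<phi> by blast
  have L: "?A \<inter> lattice_points = range (\<lambda>z. \<phi> (\<lambda>i. real_of_int (z i)))"
  proof (intro equalityI subsetI)
    fix x assume x: "x \<in> ?A \<inter> lattice_points"
    then have "real_of_int \<lfloor>Poly_Mapping.lookup x (Suc i)\<rfloor> = Poly_Mapping.lookup x (Suc i)" for i
      by (auto simp: lattice_points_def)
    then have "x = \<phi> (\<lambda>i. real_of_int \<lfloor>Poly_Mapping.lookup x (Suc i)\<rfloor>)"
      using A\<phi>[OF IntD1[OF x]] by (simp only:)
    then show "x \<in> range (\<lambda>z. \<phi> (\<lambda>i. real_of_int (z i)))"
      by (rule range_eqI[where x = "\<lambda>i. \<lfloor>Poly_Mapping.lookup x (Suc i)\<rfloor>"])
  next
    fix x assume "x \<in> range (\<lambda>z. \<phi> (\<lambda>i. real_of_int (z i)))"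
    then obtain z where x: "x = \<phi> (\<lambda>i. real_of_int (z i))" by (rule rangeE)
    have "x \<in> lattice_points"
      unfolding x lattice_points_def mem_Collect_eq look hyperplane_point_def
      by (auto intro!: Ints_diff Ints_sum)
    then show "x \<in> ?A \<inter> lattice_points" using \<phi>A x by simp
  qed
  show ?thesis
    unfolding affine_lattice_basis_def
    using inj ind A L unfolding \<phi>_def by (intro conjI)
qed

theorem normalized_volume_transversal_pairs:
  assumes part: "partition_on {1..Suc d} \<C>" and three: "3 \<le> card \<C>"
  shows "normalized_volume (convex hull (indicator_vector ` transversal_pairs \<C>)) =
    2 ^ d - (\<Sum>C\<in>\<C>. \<Sum>i<card C. real (d choose i))"
proof -
  let ?P = "convex hull (indicator_vector ` transversal_pairs \<C>)"
  let ?p = "2 *\<^sub>R Poly_Mapping.single (Suc d) (1::real)"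
  let ?v = "\<lambda>i. Poly_Mapping.single (Suc i) (1::real) - Poly_Mapping.single (Suc d) 1"
  have sub: "C \<subseteq> {1..Suc d}" if "C \<in> \<C>" for C
    using part that by (auto simp: partition_on_def)
  have "affine_lattice_basis (affine hull ?P) ?p d ?v"
    unfolding affine_hull_convex_hull affine_hull_transversal_pairs[OF finite_atLeastAtMost part three]
    by (rule affine_lattice_basis_hyperplane)
  then have vol: "normalized_volume ?P = fact d * measure (lborel_on {..<d})
      {t \<in> {..<d} \<rightarrow>\<^sub>E UNIV. ?p + (\<Sum>i<d. t i *\<^sub>R ?v i) \<in> ?P}"
    by (rule normalized_volume_eq)
  have mem: "(?p + (\<Sum>i<d. t i *\<^sub>R ?v i) \<in> ?P) \<longleftrightarrow>
      (\<forall>j\<in>{1..Suc d}. 0 \<le> hyperplane_point d t j) \<and> (\<forall>C\<in>\<C>. sum (hyperplane_point d t) C \<le> 1)" for t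
  proof -
    define x where "x = ?p + (\<Sum>i<d. t i *\<^sub>R ?v i)"
    have look: "Poly_Mapping.lookup x j = (if j \<in> {1..Suc d} then hyperplane_point d t j else 0)" for j
      unfolding x_def by (rule lookup_hyperplane_point)
    have sums: "sum (Poly_Mapping.lookup x) C = sum (hyperplane_point d t) C" if "C \<subseteq> {1..Suc d}" for C
      using that by (intro sum.cong) (auto simp: look)
    have "sum (Poly_Mapping.lookup x) {1..Suc d} = 2"
      using sums[OF order_refl] sum_hyperplane_point_total by metis
    moreover have "(\<forall>C\<in>\<C>. sum (Poly_Mapping.lookup x) C \<le> 1) \<longleftrightarrow> (\<forall>C\<in>\<C>. sum (hyperplane_point d t) C \<le> 1)"
      using sums sub by simp
    moreover have "(\<forall>j. 0 \<le> Poly_Mapping.lookup x j) \<longleftrightarrow> (\<forall>j\<in>{1..Suc d}. 0 \<le> hyperplane_point d t j)"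
      by (auto simp: look)
    moreover have "\<forall>j. j \<notin> {1..Suc d} \<longrightarrow> Poly_Mapping.lookup x j = 0"
      by (simp add: look)
    ultimately show ?thesis
      unfolding convex_hull_transversal_pairs[OF finite_atLeastAtMost part] x_def[symmetric] mem_Collect_eq
      by blast
  qed
  show ?thesis
    unfolding vol mem measure_partition_polytope[OF part] by simp
qed

section \<open>Parallel classes and bases of the lattice path matroids\<close>

definition lpm_classes :: "nat \<Rightarrow> nat \<Rightarrow> nat \<Rightarrow> nat set set" where
  "lpm_classes n k l = {{1..<n-l}, {n-k<..n}} \<union> (\<lambda>i. {i}) ` {n-l..n-k}"

context
  fixes n k l :: nat
  assumes n: "4 \<le> n" and k: "1 \<le> k" and kl: "k \<le> l" and l: "l \<le> n - 2"
begin

lemma partition_lpm_classes: "partition_on {1..n} (lpm_classes n k l)"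
proof (rule partition_onI)
  show "\<Union>(lpm_classes n k l) = {1..n}"
    using n k kl l by (auto simp: lpm_classes_def)
  show "{} \<notin> lpm_classes n k l"
    using n k kl l by (auto simp: lpm_classes_def)
  show "disjnt p q" if "p \<in> lpm_classes n k l" "q \<in> lpm_classes n k l" "p \<noteq> q" for p q
    using that n k kl l by (auto simp: lpm_classes_def disjnt_def)
qed

text \<open>The outer classes may themselves be singletons (l = n - 2 or k = 1), but they contain 1
  and n, which lie outside the middle range, so no class is counted twice.\<close>

lemma sum_lpm_classes:
  "sum f (lpm_classes n k l) = f {1..<n-l} + f {n-k<..n} + (\<Sum>i=n-l..n-k. f {i})"
proof -
  have ne: "{1..<n-l} \<noteq> {n-k<..n}"
  proof -
    have "1 \<in> {1..<n-l}" "1 \<notin> {n-k<..n}" using n k kl l by auto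
    then show ?thesis by metis
  qed
  have disj: "{1..<n-l} \<notin> (\<lambda>i. {i}) ` {n-l..n-k}" "{n-k<..n} \<notin> (\<lambda>i. {i}) ` {n-l..n-k}"
  proof -
    have "1 \<in> {1..<n-l}" "n \<in> {n-k<..n}" "1 < n - l" "n - k < n" using n k kl l by auto
    then show "{1..<n-l} \<notin> (\<lambda>i. {i}) ` {n-l..n-k}" "{n-k<..n} \<notin> (\<lambda>i. {i}) ` {n-l..n-k}"
      by fastforce+
  qed
  have "sum f (lpm_classes n k l) = sum f {{1..<n-l}, {n-k<..n}} + sum f ((\<lambda>i. {i}) ` {n-l..n-k})"
    unfolding lpm_classes_def using disj by (intro sum.union_disjoint) auto
  also have "sum f ((\<lambda>i. {i}) ` {n-l..n-k}) = (\<Sum>i=n-l..n-k. f {i})"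
    by (subst sum.reindex) auto
  finally show ?thesis using ne by simp
qed

lemma card_lpm_classes: "3 \<le> card (lpm_classes n k l)"
  using sum_lpm_classes[of "\<lambda>_. 1::nat"] kl l by simp

text \<open>For a < b, the upper path matters only at position b and demands n - l \<le> b; the
  lower path matters only at n - k and demands a \<le> n - k. If the first fails, both elements lie
  in the first class; if the second fails, both lie in the last one. Singletons never contain two
  elements.\<close>

lemma bases_M_lpm: "snd (M_lpm n k l) = transversal_pairs (lpm_classes n k l)"
proof -
  have path: "snd (lattice_path {a, b} i) = (if a \<le> i then 1 else 0) + (if b \<le> i then 1 else 0)"
    if "1 \<le> a" "a < b" for a b i
  proof -
    have "{1..i} \<inter> {a, b} = (if a \<le> i then {a} else {}) \<union> (if b \<le> i then {b} else {})"
      using that by auto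
    then show ?thesis using that by (auto simp: lattice_path_def)
  qed
  have mem: "{a, b} \<in> snd (M_lpm n k l) \<longleftrightarrow> a \<le> n - k \<and> n - l \<le> b"
    if ab: "1 \<le> a" "a < b" "b \<le> n" for a b
  proof -
    have U: "1 < n - l" and L: "1 \<le> n - k" "n - k < n" using n k kl l by auto
    have "weakly_above n {1, n - l} {a, b} \<longleftrightarrow> n - l \<le> b"
    proof
      assume "weakly_above n {1, n - l} {a, b}"
      then have "snd (lattice_path {a, b} b) \<le> snd (lattice_path {1, n - l} b)"
        using ab by (simp add: weakly_above_def)
      then show "n - l \<le> b" using ab U by (simp add: path split: if_splits)
    next
      assume "n - l \<le> b"
      then show "weakly_above n {1, n - l} {a, b}"
        using ab U by (auto simp: weakly_above_def path)
    qed
    moreover have "weakly_above n {a, b} {n - k, n} \<longleftrightarrow> a \<le> n - k"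
    proof
      assume "weakly_above n {a, b} {n - k, n}"
      then have "snd (lattice_path {n - k, n} (n - k)) \<le> snd (lattice_path {a, b} (n - k))"
        by (simp add: weakly_above_def)
      then show "a \<le> n - k" using ab L by (simp add: path split: if_splits)
    next
      assume "a \<le> n - k"
      then show "weakly_above n {a, b} {n - k, n}"
        using ab L by (auto simp: weakly_above_def path)
    qed
    ultimately show ?thesis
      using ab by (auto simp: M_lpm_def lattice_path_matroid_def)
  qed
  have same: "(\<exists>C\<in>lpm_classes n k l. a \<in> C \<and> b \<in> C) \<longleftrightarrow> \<not> (a \<le> n - k \<and> n - l \<le> b)"
    if "1 \<le> a" "a < b" "b \<le> n" for a b
    using that by (auto simp: lpm_classes_def)
  have trans: "{a, b} \<in> transversal_pairs (lpm_classes n k l) \<longleftrightarrow> a \<le> n - k \<and> n - l \<le> b"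
    if ab: "1 \<le> a" "a < b" "b \<le> n" for a b
  proof
    assume "{a, b} \<in> transversal_pairs (lpm_classes n k l)"
    then obtain a' b' C D where *: "{a, b} = {a', b'}" "C \<in> lpm_classes n k l" "D \<in> lpm_classes n k l"
      "C \<noteq> D" "a' \<in> C" "b' \<in> D"
      unfolding transversal_pairs_def by blast
    have "\<not> (\<exists>C\<in>lpm_classes n k l. a \<in> C \<and> b \<in> C)"
    proof
      assume "\<exists>C\<in>lpm_classes n k l. a \<in> C \<and> b \<in> C"
      then obtain F where "F \<in> lpm_classes n k l" "a' \<in> F" "b' \<in> F" using *(1) by (metis doubleton_eq_iff)
      then show False using * partition_on_class_unique[OF partition_lpm_classes] by metis
    qed
    then show "a \<le> n - k \<and> n - l \<le> b" using same[OF ab] by blast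
  next
    assume "a \<le> n - k \<and> n - l \<le> b"
    then have ns: "\<not> (\<exists>C\<in>lpm_classes n k l. a \<in> C \<and> b \<in> C)" using same[OF ab] by blast
    have "a \<in> \<Union>(lpm_classes n k l)" "b \<in> \<Union>(lpm_classes n k l)"
      using ab partition_onD1[OF partition_lpm_classes] by auto
    then obtain C D where "C \<in> lpm_classes n k l" "D \<in> lpm_classes n k l" "a \<in> C" "b \<in> D" by blast
    then show "{a, b} \<in> transversal_pairs (lpm_classes n k l)"
      using ns by (intro transversal_pairsI) auto
  qed
  have pairM: "\<exists>a b. B = {a, b} \<and> 1 \<le> a \<and> a < b \<and> b \<le> n" if sub: "B \<subseteq> {1..n}" and card: "card B = 2" for B
  proof -
    obtain a b where "B = {a, b}" "a \<noteq> b" using card by (auto simp: card_2_iff)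
    then have "B = {min a b, max a b} \<and> 1 \<le> min a b \<and> min a b < max a b \<and> max a b \<le> n"
      using sub by (auto simp: min_def max_def)
    then show ?thesis by blast
  qed
  have pairT: "B \<subseteq> {1..n} \<and> card B = 2" if tp: "B \<in> transversal_pairs (lpm_classes n k l)" for B
  proof -
    obtain a b C D where B: "B = {a, b}" "C \<in> lpm_classes n k l" "D \<in> lpm_classes n k l" "C \<noteq> D" "a \<in> C" "b \<in> D"
      using tp unfolding transversal_pairs_def by blast
    have "a \<noteq> b" using B partition_on_class_unique[OF partition_lpm_classes] by metis
    moreover have "a \<in> {1..n}" "b \<in> {1..n}" using B partition_onD1[OF partition_lpm_classes] by blast+
    ultimately show ?thesis using B by simp
  qed
  show ?thesis
  proof (intro set_eqI iffI)
    fix B assume B: "B \<in> snd (M_lpm n k l)"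
    then have "B \<subseteq> {1..n}" "card B = 2" by (auto simp: M_lpm_def lattice_path_matroid_def)
    then obtain a b where "B = {a, b}" "1 \<le> a" "a < b" "b \<le> n" using pairM by blast
    then show "B \<in> transversal_pairs (lpm_classes n k l)" using mem trans B by simp
  next
    fix B assume B: "B \<in> transversal_pairs (lpm_classes n k l)"
    then obtain a b where "B = {a, b}" "1 \<le> a" "a < b" "b \<le> n" using pairM[of B] pairT[OF B] by blast
    then show "B \<in> snd (M_lpm n k l)" using mem trans B by simp
  qed
qed

theorem \<sigma>_eq_sum_binomial:
  "\<sigma> n k l = (\<Sum>i=k..l. real ((n - 1) choose i)) - (real l - real k + 1)"
proof -
  define d where "d = n - 1"
  have nd: "n = Suc d" using n by (simp add: d_def)
  let ?g = "\<lambda>c. \<Sum>i<c. real (d choose i)"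
  have "\<sigma> n k l = normalized_volume (convex hull (indicator_vector ` transversal_pairs (lpm_classes n k l)))"
    using n k kl l by (simp add: \<sigma>_def matroid_polytope_def bases_M_lpm)
  also have "\<dots> = 2 ^ d - (\<Sum>C\<in>lpm_classes n k l. ?g (card C))"
    using normalized_volume_transversal_pairs[OF partition_lpm_classes[unfolded nd] card_lpm_classes[unfolded nd]]
    by (simp add: nd)
  \<comment> \<open>Each of the l - k + 1 singletons contributes \<open>?g 1\<close>, which is
    1.\<close>
  also have "(\<Sum>C\<in>lpm_classes n k l. ?g (card C)) = ?g (n - l - 1) + ?g k + (real l - real k + 1)"
    using n k kl l by (subst sum_lpm_classes) (simp add: of_nat_diff)
  also have "?g (n - l - 1) = (\<Sum>i=Suc l..d. real (d choose i))"
  proof -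
    have "n - l - 1 = Suc (d - Suc l)" "d - (d - Suc l) = Suc l" using n k kl l by (auto simp: d_def)
    then show ?thesis using sum_binomial_upper[of "d - Suc l" d] by simp
  qed
  also have "2 ^ d - ((\<Sum>i=Suc l..d. real (d choose i)) + ?g k + (real l - real k + 1)) =
      (\<Sum>i=k..l. real (d choose i)) - (real l - real k + 1)"
  proof -
    have "(\<Sum>i=k..d. real (d choose i)) = (\<Sum>i=k..l. real (d choose i)) + (\<Sum>i=Suc l..d. real (d choose i))"
      using n k kl l by (subst sum.union_disjoint[symmetric]) (auto simp: d_def intro!: sum.cong)
    moreover have "k \<le> d" using n k kl l by (simp add: d_def)
    ultimately show ?thesis using sum_binomial_split[of k d] by simp
  qed
  finally show ?thesis by (simp add: d_def)
qed

end

section \<open>Polynomiality in n and the three claims\<close>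

text \<open>The binomial coefficient (X - 1 choose i) as a polynomial in X; the roots are shifted by
  1 because the volume formula has n - 1 on top.\<close>

definition binomial_poly :: "nat \<Rightarrow> real poly" where
  "binomial_poly i = smult (1 / fact i) (\<Prod>j<i. [:- (1 + real j), 1:])"

lemma degree_binomial_poly: "degree (binomial_poly i) = i"
proof -
  have "degree (\<Prod>j<i. [:- (1 + real j), 1:]) = (\<Sum>j<i. degree [:- (1 + real j), 1:])"
    by (rule degree_prod_eq_sum_degree) simp
  then show ?thesis by (simp add: binomial_poly_def)
qed

lemma poly_binomial_poly:
  assumes "1 \<le> m"
  shows "poly (binomial_poly i) (real m) = real ((m - 1) choose i)"
proof -
  have "real ((m - 1) choose i) = (\<Prod>j<i. real (m - 1) - real j) / fact i"
    by (simp add: binomial_gbinomial gbinomial_prod_rev atLeast0LessThan)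
  also have "(\<Prod>j<i. real (m - 1) - real j) = (\<Prod>j<i. - (1 + real j) + real m)"
    using assms by (intro prod.cong) (auto simp: of_nat_diff)
  finally show ?thesis by (simp add: binomial_poly_def poly_prod)
qed

theorem theorem5p8:
  fixes n k l :: nat
  assumes "4 \<le> n" and "1 \<le> k" and "k \<le> l" and "l \<le> n - 2"
  shows "\<sigma> n k k = real ((n - 1) choose k) - 1 \<and>
         \<sigma> n k (l - 1) + \<sigma> n k l + (real ((n - 1) choose (k - 1)) + real l - real k) = \<sigma> (n + 1) k l \<and>
         (\<exists>p :: real poly. degree p = l \<and>
            (\<forall>m. 4 \<le> m \<and> l \<le> m - 2 \<longrightarrow> \<sigma> m k l = poly p (real m)))"
proof (intro conjI)
  show "\<sigma> n k k = real ((n - 1) choose k) - 1"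
    using assms by (subst \<sigma>_eq_sum_binomial) auto
next
  obtain k' where k': "k = Suc k'" using assms by (cases k) auto
  obtain l' where l': "l = Suc l'" using assms by (cases l) auto
  obtain d where d: "n = Suc d" using assms by (cases n) auto
  have "\<sigma> n k (l - 1) = (\<Sum>i=k..l-1. real ((n - 1) choose i)) - (real l - real k)"
  proof (cases "k = l")
    \<comment> \<open>Outside the admissible range \<open>\<sigma>\<close> is 0 by convention, which
      agrees with the empty sum and the vanishing correction l - k.\<close>
    case True
    moreover have "\<not> k \<le> l - 1" using True assms by simp
    ultimately show ?thesis by (simp add: \<sigma>_def)
  next
    case False
    then show ?thesis using assms by (subst \<sigma>_eq_sum_binomial) (auto simp: of_nat_diff)
  qed
  moreover have "\<sigma> n k l = (\<Sum>i=k..l. real ((n - 1) choose i)) - (real l - real k + 1)"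
    using assms by (intro \<sigma>_eq_sum_binomial)
  moreover have "\<sigma> (n + 1) k l = (\<Sum>i=k..l. real (n choose i)) - (real l - real k + 1)"
    using assms by (subst \<sigma>_eq_sum_binomial) auto
  \<comment> \<open>Pascal's rule termwise; the lower entries run from k - 1 to l - 1, and the one
    at k - 1 is the extra binomial term of the recurrence.\<close>
  moreover have "(\<Sum>i=k..l. real (n choose i)) = (\<Sum>i=k..l. real ((n - 1) choose i)) +
      (real ((n - 1) choose (k - 1)) + (\<Sum>i=k..l-1. real ((n - 1) choose i)))"
  proof -
    have "(\<Sum>i=k..l. real (n choose i)) = (\<Sum>i=k'..l'. real (Suc d choose Suc i))"
      unfolding k' l' d by (rule sum.shift_bounds_cl_Suc_ivl)
    also have "\<dots> = (\<Sum>i=k'..l'. real (d choose Suc i)) + (\<Sum>i=k'..l'. real (d choose i))"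
      by (simp add: sum.distrib add.commute)
    also have "(\<Sum>i=k'..l'. real (d choose Suc i)) = (\<Sum>i=k..l. real (d choose i))"
      unfolding k' l' by (rule sum.shift_bounds_cl_Suc_ivl[symmetric])
    also have "(\<Sum>i=k'..l'. real (d choose i)) = real (d choose k') + (\<Sum>i=Suc k'..l'. real (d choose i))"
      using assms k' l' by (intro sum.atLeast_Suc_atMost) auto
    finally show ?thesis by (simp add: k' l' d)
  qed
  ultimately show "\<sigma> n k (l - 1) + \<sigma> n k l + (real ((n - 1) choose (k - 1)) + real l - real k) = \<sigma> (n + 1) k l"
    by simp
next
  \<comment> \<open>Everything but the summand i = l. As l \<ge> 1, both the remaining binomials and
    the constant have degree at most l - 1, so the leading term cannot cancel.\<close>
  define q where "q = (\<Sum>i\<in>{k..<l}. binomial_poly i) - [:real l - real k + 1:]"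
  have "degree (\<Sum>i\<in>{k..<l}. binomial_poly i) \<le> l - 1"
    by (rule degree_sum_le) (auto simp: degree_binomial_poly)
  then have "degree q \<le> l - 1"
    unfolding q_def by (intro degree_diff_le) auto
  then have "degree (binomial_poly l + q) = l"
    using assms by (subst degree_add_eq_left) (auto simp: degree_binomial_poly)
  moreover have "\<sigma> m k l = poly (binomial_poly l + q) (real m)" if m: "4 \<le> m \<and> l \<le> m - 2" for m
  proof -
    have "{k..l} = insert l {k..<l}" using assms by auto
    then have "(\<Sum>i=k..l. real ((m - 1) choose i)) = real ((m - 1) choose l) + (\<Sum>i\<in>{k..<l}. real ((m - 1) choose i))"
      by simp
    then show ?thesis
      using assms m by (subst \<sigma>_eq_sum_binomial) (auto simp: q_def poly_sum poly_binomial_poly)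
  qed
  ultimately show "\<exists>p :: real poly. degree p = l \<and>
      (\<forall>m. 4 \<le> m \<and> l \<le> m - 2 \<longrightarrow> \<sigma> m k l = poly p (real m))"
    by blast
qed

end
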